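(* Let $P\subset\mathbb{R}^d$ be a full-dimensional convex polytope with $f_1(P)$ edges. Then every irreducible component of the algebraic boundary $\partial_a IP$ of the intersection body $IP$ has degree at most $f_1(P)-(d-1)$.
   Context: The intersection body $IP$ has radial function $\rho_{IP}(x)=\frac{1}{\|x\|}\operatorname{Vol}_{d-1}(P\cap x^\perp)$ for $x\ne0$, where $x^\perp=\{y:\langle x,y\rangle=0\}$, and $IP=\{x\ne 0:\rho_{IP}(x)\ge1\}\cup\{0\}$. For a compact set $K\subset\mathbb{R}^d$, its algebraic boundary $\partial_a K$ is the Zariski closure (over $\mathbb{R}$) of its Euclidean boundary $\partial K$; it is a union of irreducible hypersurfaces, its irreducible components. *)

theory Defs
  imports "HOL-Analysis.Analysis"
begin

definition is_mpoly :: "(('n::finite \<Rightarrow> nat) \<Rightarrow> real) \<Rightarrow> bool" where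
  "is_mpoly c \<longleftrightarrow> finite {\<alpha>. c \<alpha> \<noteq> 0}"

definition mpoly_eval :: "(('n::finite \<Rightarrow> nat) \<Rightarrow> real) \<Rightarrow> real^'n \<Rightarrow> real" where
  "mpoly_eval c x = (\<Sum>\<alpha>\<in>{\<alpha>. c \<alpha> \<noteq> 0}. c \<alpha> * (\<Prod>i\<in>UNIV. (x $ i) ^ (\<alpha> i)))"

definition mpoly_deg :: "(('n::finite \<Rightarrow> nat) \<Rightarrow> real) \<Rightarrow> nat" where
  "mpoly_deg c = Max (insert 0 {(\<Sum>i\<in>UNIV. \<alpha> i) | \<alpha>. c \<alpha> \<noteq> 0})"

definition zariski_closed :: "(real^'n::finite) set \<Rightarrow> bool" where
  "zariski_closed V \<longleftrightarrow>
     (\<exists>F. (\<forall>c\<in>F. is_mpoly c) \<and> V = {x. \<forall>c\<in>F. mpoly_eval c x = 0})"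

definition zariski_closure :: "(real^'n::finite) set \<Rightarrow> (real^'n) set" where
  "zariski_closure S =
     {x. \<forall>c. is_mpoly c \<and> (\<forall>y\<in>S. mpoly_eval c y = 0) \<longrightarrow> mpoly_eval c x = 0}"

definition zariski_irreducible :: "(real^'n::finite) set \<Rightarrow> bool" where
  "zariski_irreducible V \<longleftrightarrow> V \<noteq> {} \<and> zariski_closed V \<and>
     (\<forall>A B. zariski_closed A \<longrightarrow> zariski_closed B \<longrightarrow> V = A \<union> B \<longrightarrow> V = A \<or> V = B)"

definition irreducible_component :: "(real^'n::finite) set \<Rightarrow> (real^'n) set \<Rightarrow> bool" where
  "irreducible_component C W \<longleftrightarrow> C \<subseteq> W \<and> zariski_irreducible C \<and>
     (\<forall>C'. zariski_irreducible C' \<and> C \<subseteq> C' \<and> C' \<subseteq> W \<longrightarrow> C' = C)"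

text \<open>Degree of an irreducible hypersurface: the degree of its defining irreducible
polynomial, i.e. the least degree of a nonzero polynomial vanishing on it.\<close>

definition hypersurface_degree :: "(real^'n::finite) set \<Rightarrow> nat" where
  "hypersurface_degree V = (LEAST n. \<exists>c. is_mpoly c \<and> c \<noteq> (\<lambda>_. 0) \<and>
      mpoly_deg c = n \<and> (\<forall>x\<in>V. mpoly_eval c x = 0))"

definition algebraic_boundary :: "(real^'n::finite) set \<Rightarrow> (real^'n) set" where
  "algebraic_boundary K = zariski_closure (frontier K)"

text \<open>(d-1)-volume of a set S contained in the hyperplane x^perp, computed as the
d-dimensional Lebesgue measure of the right prism of height 1 over S in the
unit normal direction x/|x|.\<close>

definition section_volume :: "(real^'n::finite) set \<Rightarrow> real^'n \<Rightarrow> real" where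
  "section_volume P x = measure lebesgue
     {y + t *\<^sub>R (x /\<^sub>R norm x) | y t. y \<in> P \<and> x \<bullet> y = 0 \<and> t \<in> {0..1}}"

definition radial_IP :: "(real^'n::finite) set \<Rightarrow> real^'n \<Rightarrow> real" where
  "radial_IP P x = section_volume P x / norm x"

definition intersection_body :: "(real^'n::finite) set \<Rightarrow> (real^'n) set" where
  "intersection_body P = {x. x \<noteq> 0 \<and> radial_IP P x \<ge> 1} \<union> {0}"

definition num_edges :: "(real^'n::finite) set \<Rightarrow> nat" where
  "num_edges P = card {E. E face_of P \<and> aff_dim E = 1}"

end

theory Submission
  imports Defs
begin

text \<open>
  An irreducible set contained in a finite union of zero sets of polynomials lies in one of them, so
  it suffices to cover the boundary of the intersection body by the zero sets of finitely many
  nonzero polynomials of degree at most \<open>f\<^sub>1(P) - (d - 1)\<close>.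

  Call \<open>x\<close> generic if it separates the vertices of \<open>P\<close> and the origin from each other. Non-generic
  points lie on finitely many hyperplanes. Near a generic \<open>x\<close> the radial function is continuous, so
  a generic boundary point satisfies \<open>\<rho>(x) = 1\<close>. Triangulate the section \<open>P \<inter> x\<^sup>\<bottom>\<close> without new
  vertices. Its nonzero vertices are the points \<open>a - (\<langle>a,x\<rangle> / \<langle>b-a,x\<rangle>) (b-a)\<close> on the edges
  \<open>[a,b]\<close> that cross \<open>x\<^sup>\<bottom>\<close>, so each simplex contributes to \<open>\<rho>(x)\<close> a constant times the absolute
  value of a determinant divided by the product of the forms \<open>\<langle>b-a,x\<rangle>\<close> over distinct crossing
  edges. With \<open>q\<close> the product of these forms over all crossing edges, \<open>q - q \<rho>\<close> is a polynomial
  of degree at most the number of crossing edges, and it does not vanish at \<open>2x\<close> because \<open>\<rho>\<close> is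
  homogeneous of degree -1. Only finitely many sign patterns and edge sets occur.

  Finally, at least \<open>d - 1\<close> edges do not cross \<open>x\<^sup>\<bottom>\<close>: every vertex other than the two optimal ones
  for \<open>x\<close> has an edge leading strictly away from the hyperplane.
\<close>

subsection \<open>Triangulations of polytopes\<close>

text \<open>The smallest face \<open>F\<close> containing \<open>x\<close> does it: a point of
  \<open>F\<close> outside the relative interior lies on a facet of \<open>F\<close>, which is a
  smaller face of \<open>S\<close> through \<open>x\<close>.\<close>

lemma polytope_point_in_rel_interior_face:
  fixes S :: "'a::euclidean_space set"
  assumes "polytope S" "x \<in> S"
  obtains F where "F face_of S" "x \<in> rel_interior F"
proof -
  define F where "F = \<Inter>{F. F face_of S \<and> x \<in> F}"
  have ne: "{F. F face_of S \<and> x \<in> F} \<noteq> {}"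
    using assms face_of_refl polytope_imp_convex by blast
  have F: "F face_of S"
    unfolding F_def by (rule face_of_Inter[OF ne]) auto
  have "x \<in> F" by (auto simp: F_def)
  have "polyhedron F"
    using F assms face_of_polytope_polytope polytope_imp_polyhedron by blast
  have "x \<in> rel_interior F"
  proof (rule ccontr)
    assume "x \<notin> rel_interior F"
    then obtain G where G: "G facet_of F" "x \<in> G"
      using rel_interior_of_polyhedron[OF \<open>polyhedron F\<close>] \<open>x \<in> F\<close> by blast
    then have "G face_of S" using face_of_trans[OF facet_of_imp_face_of[OF G(1)] F] by simp
    then have "F \<subseteq> G" using G(2) by (auto simp: F_def)
    then have "F = G" using facet_of_imp_subset[OF G(1)] by simp
    then show False using G(1) by simp
  qed
  then show ?thesis using F that by blast
qed

lemma rel_interior_extend: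
  fixes F :: "'a::euclidean_space set"
  assumes "g \<in> rel_interior F" "z \<in> affine hull F"
  obtains e where "e > 0" "g + e *\<^sub>R (z - g) \<in> F" "g - e *\<^sub>R (z - g) \<in> F"
proof -
  obtain e where e: "e > 0" "cball g e \<inter> affine hull F \<subseteq> F" "g \<in> F"
    using assms(1) by (auto simp: mem_rel_interior_cball)
  \<comment> \<open>The summand 1 keeps the denominator positive when \<open>z = g\<close>.\<close>
  define d where "d = e / (1 + norm (z - g))"
  have n: "1 + norm (z - g) > 0"
    by (smt (verit) norm_ge_zero)
  have d: "d > 0" "d * norm (z - g) \<le> e"
    using e n by (auto simp: d_def field_simps)
  have g: "g \<in> affine hull F"
    using e(3) by (rule hull_inc)
  have aff: "g + t *\<^sub>R (z - g) \<in> affine hull F" for t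
    using mem_affine[OF affine_affine_hull[of F] g assms(2), of "1 - t" t]
    by (simp add: algebra_simps)
  have "g + d *\<^sub>R (z - g) \<in> F"
    using aff[of d] d e by (auto simp: dist_norm)
  moreover have "g - d *\<^sub>R (z - g) \<in> F"
    using aff[of "- d"] d e by (auto simp: dist_norm)
  ultimately show ?thesis using that d(1) by blast
qed

text \<open>Prolong the ray from \<open>w\<close> through \<open>y\<close> to its last point
  \<open>g\<close> in \<open>Q\<close>. The face with \<open>g\<close> in its relative interior
  cannot contain \<open>w\<close>, since the ray could then be prolonged inside it. Being a proper
  face, it is an intersection of facets, and one of these misses \<open>w\<close>.\<close>

lemma cone_over_facet_covers:
  fixes Q :: "'a::euclidean_space set"
  assumes Q: "polytope Q" and w: "w \<in> Q" and y: "y \<in> Q" "y \<noteq> w"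
  obtains G g p where "G facet_of Q" "w \<notin> G" "g \<in> G" "0 \<le> p" "p \<le> 1"
    "y = (1 - p) *\<^sub>R w + p *\<^sub>R g"
proof -
  define I where "I = {s. w + s *\<^sub>R (y - w) \<in> Q}"
  have "1 \<in> I" using y by (simp add: I_def)
  have "closed I"
  proof -
    have "closed ((\<lambda>s. w + s *\<^sub>R (y - w)) -` Q)"
      by (intro closed_vimage polytope_imp_closed Q continuous_intros)
    then show ?thesis by (simp add: I_def vimage_def)
  qed
  moreover have "bounded I"
  proof -
    obtain B where B: "\<And>z. z \<in> Q \<Longrightarrow> norm z \<le> B"
      using polytope_imp_bounded[OF Q] by (auto simp: bounded_iff)
    have "norm s \<le> (B + norm w) / norm (y - w)" if "s \<in> I" for s
    proof -
      have "norm (w + s *\<^sub>R (y - w)) \<le> B" using that B by (auto simp: I_def)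
      then have "\<bar>s\<bar> * norm (y - w) \<le> B + norm w"
        using norm_triangle_ineq4[of "w + s *\<^sub>R (y - w)" w] by simp
      then show ?thesis using y(2) by (simp add: field_simps)
    qed
    then show ?thesis by (auto simp: bounded_iff)
  qed
  ultimately have "compact I" using compact_eq_bounded_closed by blast
  then obtain s where s: "s \<in> I" "\<And>t. t \<in> I \<Longrightarrow> t \<le> s"
    using compact_attains_sup[of I] \<open>1 \<in> I\<close> by blast
  have s1: "1 \<le> s" using s \<open>1 \<in> I\<close> by blast
  define g where "g = w + s *\<^sub>R (y - w)"
  have g: "g \<in> Q" using s by (simp add: I_def g_def)
  obtain F where F: "F face_of Q" "g \<in> rel_interior F"
    using polytope_point_in_rel_interior_face[OF Q g] by blast
  have wF: "w \<notin> F"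
  proof
    assume "w \<in> F"
    then obtain e where e: "e > 0" "g - e *\<^sub>R (w - g) \<in> F"
      using rel_interior_extend[OF F(2), of w] hull_inc by metis
    have "g - e *\<^sub>R (w - g) = w + (s + e * s) *\<^sub>R (y - w)"
      by (simp add: g_def algebra_simps)
    then have "s + e * s \<in> I" using e F(1) face_of_imp_subset by (fastforce simp: I_def)
    then show False using s(2) e(1) s1 by (smt (verit) mult_pos_pos)
  qed
  have "F \<noteq> Q" "F \<noteq> {}" using wF w F by auto
  then have "F = \<Inter>{G. G facet_of Q \<and> F \<subseteq> G}"
    using face_of_polyhedron[OF polytope_imp_polyhedron[OF Q] F(1)] by blast
  then obtain G where G: "G facet_of Q" "F \<subseteq> G" "w \<notin> G"
    using wF by blast
  have "g \<in> G" using F G rel_interior_subset by blast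
  moreover have "y = (1 - 1 / s) *\<^sub>R w + (1 / s) *\<^sub>R g"
  proof -
    have "y = w + ((1 / s) * s) *\<^sub>R (y - w)" using s1 by simp
    then show ?thesis unfolding g_def by (simp only: algebra_simps) simp
  qed
  ultimately show ?thesis
    using that[OF G(1) G(3), of g "1 / s"] s1 by simp
qed

text \<open>Let a common point lie at fraction \<open>p\<close> of the way from \<open>w\<close> to
  \<open>g\<close> and at fraction \<open>q\<close> of the way to \<open>h\<close>. If
  \<open>0 < p < q\<close>, then \<open>h\<close> is strictly between \<open>w\<close> and
  \<open>g\<close>, so the face containing \<open>h\<close> would contain \<open>w\<close>. Hence
  \<open>p = q\<close> and \<open>g = h\<close>, unless the point is \<open>w\<close>
  itself.\<close>

lemma cones_over_faces_Int:
  fixes Q :: "'a::real_vector set"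
  assumes "w \<in> Q" "G face_of Q" "G' face_of Q" "w \<notin> G" "w \<notin> G'"
    and A: "A \<noteq> {}" "convex hull A \<subseteq> G" and B: "B \<noteq> {}" "convex hull B \<subseteq> G'"
  shows "convex hull (insert w A) \<inter> convex hull (insert w B)
         \<subseteq> convex hull (insert w (convex hull A \<inter> convex hull B))"
proof
  fix y assume "y \<in> convex hull (insert w A) \<inter> convex hull (insert w B)"
  then obtain p g q h where
    p: "0 \<le> p" "p \<le> 1" "g \<in> convex hull A" "y = (1 - p) *\<^sub>R w + p *\<^sub>R g" and
    q: "0 \<le> q" "q \<le> 1" "h \<in> convex hull B" "y = (1 - q) *\<^sub>R w + q *\<^sub>R h"
    by (auto simp: convex_hull_insert_alt A B)
  have sub: "G \<subseteq> Q" "G' \<subseteq> Q" using assms(2,3) by (simp_all add: face_of_imp_subset)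
  let ?C = "convex hull (insert w (convex hull A \<inter> convex hull B))"
  have wC: "w \<in> ?C" by (simp add: hull_inc)
  have no: False if "0 < r" "r < t" "K face_of Q" "w \<notin> K" "u \<in> K" "v \<in> Q" "v \<noteq> w"
    "(1 - r) *\<^sub>R w + r *\<^sub>R v = (1 - t) *\<^sub>R w + t *\<^sub>R u" for r t K u v
  proof -
    have "t *\<^sub>R u = t *\<^sub>R w + r *\<^sub>R (v - w)" using that(8) by (simp add: algebra_simps)
    then have "(1/t) *\<^sub>R (t *\<^sub>R u) = (1/t) *\<^sub>R (t *\<^sub>R w + r *\<^sub>R (v - w))" by simp
    then have "u = w + (r / t) *\<^sub>R (v - w)" using that by (simp add: scaleR_add_right)
    then have "u = (1 - r / t) *\<^sub>R w + (r / t) *\<^sub>R v" by (simp add: algebra_simps)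
    then have "u \<in> open_segment w v"
      using that by (auto simp: in_segment intro!: exI[of _ "r / t"])
    then show False using face_ofD[OF that(3)] that \<open>w \<in> Q\<close> by blast
  qed
  consider "p = 0" | "q = 0" | "p > 0" "p < q" | "q > 0" "q < p" | "p = q" "p > 0"
    using p q by linarith
  then show "y \<in> ?C"
  proof cases
    case 1 then show ?thesis using p wC by simp
  next
    case 2 then show ?thesis using q wC by simp
  next
    case 3
    then have False using no[of p q G' h g] assms p q sub by auto
    then show ?thesis ..
  next
    case 4
    then have False using no[of q p G g h] assms p q sub by auto
    then show ?thesis ..
  next
    case 5
    then have "g = h" using p(4) q(4) by simp
    then have "g \<in> ?C" using p q by (simp add: hull_inc)
    then show ?thesis using convexD[OF convex_convex_hull wC, of g "1 - p" p] p by simp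
  qed
qed

text \<open>The pulling triangulation: cone off from one vertex the triangulations of the facets
  missing it.\<close>

lemma polytope_triangulation:
  fixes Q :: "'a::euclidean_space set"
  assumes "polytope Q"
  shows "\<exists>T. finite T \<and> (\<forall>t\<in>T. t \<subseteq> {x. x extreme_point_of Q} \<and> finite t \<and> int (card t) = aff_dim Q + 1)
     \<and> Q = (\<Union>t\<in>T. convex hull t)
     \<and> pairwise (\<lambda>s t. aff_dim (convex hull s \<inter> convex hull t) < aff_dim Q) T"
  using assms
\<comment> \<open>\<open>aff_dim\<close> is -1 on the empty set, so the measure is shifted by
  one.\<close>
proof (induction "nat (aff_dim Q + 1)" arbitrary: Q rule: less_induct)
  case less
  show ?case
  proof (cases "aff_dim Q \<le> 0")
    case True
    have "aff_dim Q = -1 \<or> aff_dim Q = 0" using True aff_dim_geq[of Q] by linarith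
    then consider "Q = {}" | w where "Q = {w}" using aff_dim_empty[of Q] aff_dim_eq_0[of Q] by blast
    then show ?thesis
    proof cases
      case 1 then show ?thesis by (intro exI[of _ "{}"]) auto
    next
      case (2 w) then show ?thesis by (intro exI[of _ "{{w}}"]) auto
    qed
  next
    case False
    then have d: "aff_dim Q \<ge> 1" by simp
    have "Q \<noteq> {}" using d by auto
    then obtain w where w: "w extreme_point_of Q"
      using extreme_point_exists_convex less.prems polytope_imp_compact polytope_imp_convex by blast
    then have wQ: "w \<in> Q" by (simp add: extreme_point_of_def)
    define \<G> where "\<G> = {G. G facet_of Q \<and> w \<notin> G}"
    have fin: "finite \<G>"
      unfolding \<G>_def using finite_polytope_facets[OF less.prems] by (rule rev_finite_subset) auto
    have G: "G face_of Q" "G \<subseteq> Q" "G \<noteq> {}" "w \<notin> G" "aff_dim G = aff_dim Q - 1" "polytope G"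
      if "G \<in> \<G>" for G
    proof -
      show F: "G face_of Q" and "G \<noteq> {}" "w \<notin> G" "aff_dim G = aff_dim Q - 1"
        using that by (auto simp: \<G>_def facet_of_def)
      show "G \<subseteq> Q" by (rule face_of_imp_subset[OF F])
      show "polytope G" by (rule face_of_polytope_polytope[OF less.prems F])
    qed
    have "\<forall>G\<in>\<G>. \<exists>T. finite T \<and>
      (\<forall>t\<in>T. t \<subseteq> {x. x extreme_point_of G} \<and> finite t \<and> int (card t) = aff_dim G + 1)
     \<and> G = (\<Union>t\<in>T. convex hull t)
     \<and> pairwise (\<lambda>s t. aff_dim (convex hull s \<inter> convex hull t) < aff_dim G) T"
    proof
      fix K assume K: "K \<in> \<G>"
      have "nat (aff_dim K + 1) < nat (aff_dim Q + 1)" using G(5)[OF K] d by simp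
      from less.hyps[OF this G(6)[OF K]] show "\<exists>T. finite T \<and>
        (\<forall>t\<in>T. t \<subseteq> {x. x extreme_point_of K} \<and> finite t \<and> int (card t) = aff_dim K + 1)
         \<and> K = (\<Union>t\<in>T. convex hull t)
         \<and> pairwise (\<lambda>s t. aff_dim (convex hull s \<inter> convex hull t) < aff_dim K) T" .
    qed
    from bchoice[OF this] obtain T where TT: "\<forall>G\<in>\<G>. finite (T G) \<and>
      (\<forall>t\<in>T G. t \<subseteq> {x. x extreme_point_of G} \<and> finite t \<and> int (card t) = aff_dim G + 1)
     \<and> G = (\<Union>t\<in>T G. convex hull t)
     \<and> pairwise (\<lambda>s t. aff_dim (convex hull s \<inter> convex hull t) < aff_dim G) (T G)" ..
    have T: "finite (T G)"
      "\<And>t. t \<in> T G \<Longrightarrow> t \<subseteq> {x. x extreme_point_of G} \<and> finite t \<and> int (card t) = aff_dim G + 1"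
      "G = (\<Union>t\<in>T G. convex hull t)"
      "pairwise (\<lambda>s t. aff_dim (convex hull s \<inter> convex hull t) < aff_dim G) (T G)"
      if "G \<in> \<G>" for G
      using bspec[OF TT that] by blast+
    have t: "t \<subseteq> G" "w \<notin> t" "t \<noteq> {}" "convex hull t \<subseteq> G" if "G \<in> \<G>" "t \<in> T G" for G t
    proof -
      show "t \<subseteq> G" "w \<notin> t" using T(2)[OF that] G[OF that(1)] by (auto simp: extreme_point_of_def)
      show "t \<noteq> {}" using T(2)[OF that] G[OF that(1)] d by auto
      show "convex hull t \<subseteq> G" using T(3)[OF that(1)] that(2) by blast
    qed
    define U where "U = (\<Union>G\<in>\<G>. insert w ` T G)"
    have "finite U" using fin T(1) by (auto simp: U_def)
    moreover have "t \<subseteq> {x. x extreme_point_of Q} \<and> finite t \<and> int (card t) = aff_dim Q + 1"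
      if tU: "t \<in> U" for t
    proof -
      from that obtain G s where s: "G \<in> \<G>" "s \<in> T G" "t = insert w s" by (auto simp: U_def)
      have "s \<subseteq> {x. x extreme_point_of Q}"
        using T(2)[OF s(1,2)] extreme_point_of_face[OF G(1)[OF s(1)]] by auto
      then show ?thesis using s T(2)[OF s(1,2)] G(5)[OF s(1)] t(2)[OF s(1,2)] w by auto
    qed
    moreover have "Q = (\<Union>t\<in>U. convex hull t)"
    proof
      show "(\<Union>t\<in>U. convex hull t) \<subseteq> Q"
      proof (rule UN_least)
        fix r assume "r \<in> U"
        then obtain K s where s: "K \<in> \<G>" "s \<in> T K" "r = insert w s" by (auto simp: U_def)
        have "r \<subseteq> Q" using s(3) t(1)[OF s(1,2)] G(2)[OF s(1)] wQ by blast
        then show "convex hull r \<subseteq> Q" by (rule hull_minimal) (rule polytope_imp_convex[OF less.prems])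
      qed
      \<comment> \<open>The apex lies in every cone, but that there is a cone at all follows only
        from a point other than \<open>w\<close>; so both claims are proved together.\<close>
      have main: "y \<in> (\<Union>t\<in>U. convex hull t) \<and> w \<in> (\<Union>t\<in>U. convex hull t)"
        if y: "y \<in> Q" "y \<noteq> w" for y
      proof -
        obtain K g p where K: "K facet_of Q" "w \<notin> K" "g \<in> K" "0 \<le> p" "p \<le> 1"
          "y = (1 - p) *\<^sub>R w + p *\<^sub>R g"
          using cone_over_facet_covers[OF less.prems wQ y] by blast
        then have KG: "K \<in> \<G>" by (simp add: \<G>_def)
        then obtain s where s: "s \<in> T K" "g \<in> convex hull s" using T(3)[OF KG] K by blast
        have g: "g \<in> convex hull (insert w s)" using s(2) by (meson hull_mono subsetD subset_insertI)
        have w': "w \<in> convex hull (insert w s)" by (simp add: hull_inc)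
        have "y \<in> convex hull (insert w s)"
          using convexD[OF convex_convex_hull w' g, of "1 - p" p] K by simp
        then show ?thesis using w' s(1) KG by (auto simp: U_def)
      qed
      have "Q \<noteq> {w}" using d by auto
      then obtain y where "y \<in> Q" "y \<noteq> w" using wQ by blast
      then show "Q \<subseteq> (\<Union>t\<in>U. convex hull t)" using main by blast
    qed
    moreover have "pairwise (\<lambda>s t. aff_dim (convex hull s \<inter> convex hull t) < aff_dim Q) U"
    proof (rule pairwiseI)
      fix s' t' assume "s' \<in> U" "t' \<in> U" "s' \<noteq> t'"
      then obtain K s L r where s: "K \<in> \<G>" "s \<in> T K" "s' = insert w s"
        and r: "L \<in> \<G>" "r \<in> T L" "t' = insert w r" "s \<noteq> r" by (auto simp: U_def)
      let ?I = "convex hull s \<inter> convex hull r"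
      \<comment> \<open>The bases have to overlap in codimension at least two of \<open>Q\<close>,
        because coning from \<open>w\<close> adds one dimension. Two simplices in one facet do so by
        induction, and two distinct facets meet in a proper face of each.\<close>
      have lt: "aff_dim ?I < aff_dim Q - 1"
      proof (cases "K = L")
        case True
        then show ?thesis using T(4)[OF s(1)] s r G(5)[OF s(1)] by (auto simp: pairwise_def)
      next
        case False
        have "K \<inter> L face_of K"
          using G(1)[OF s(1)] G(1)[OF r(1)] by (meson face_of_Int face_of_face inf_le1)
        moreover have "K \<inter> L \<noteq> K"
        proof
          assume "K \<inter> L = K"
          then have "K face_of L" using G(1)[OF s(1)] G(1)[OF r(1)] face_of_face by blast
          then have "aff_dim K < aff_dim L"
            using face_of_aff_dim_lt[of L K] False G(6)[OF r(1)] polytope_imp_convex by blast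
          then show False using G(5)[OF s(1)] G(5)[OF r(1)] by simp
        qed
        ultimately have "aff_dim (K \<inter> L) < aff_dim K"
          using face_of_aff_dim_lt G(6)[OF s(1)] polytope_imp_convex by blast
        moreover have "aff_dim ?I \<le> aff_dim (K \<inter> L)"
          using t(4)[OF s(1,2)] t(4)[OF r(1,2)] by (intro aff_dim_subset) auto
        ultimately show ?thesis using G(5)[OF s(1)] by simp
      qed
      have "convex hull s' \<inter> convex hull t' \<subseteq> convex hull (insert w ?I)"
        unfolding s(3) r(3)
        by (rule cones_over_faces_Int[OF wQ G(1)[OF s(1)] G(1)[OF r(1)] G(4)[OF s(1)] G(4)[OF r(1)]
              t(3)[OF s(1,2)] t(4)[OF s(1,2)] t(3)[OF r(1,2)] t(4)[OF r(1,2)]])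
      then have "aff_dim (convex hull s' \<inter> convex hull t') \<le> aff_dim (insert w ?I)"
        by (metis aff_dim_convex_hull aff_dim_subset)
      also have "\<dots> \<le> aff_dim ?I + 1" by (simp add: aff_dim_insert)
      finally show "aff_dim (convex hull s' \<inter> convex hull t') < aff_dim Q" using lt by simp
    qed
    ultimately show ?thesis by (intro exI[of _ U]) auto
  qed
qed

subsection \<open>Hyperplane sections and edges\<close>

text \<open>Let \<open>F\<close> be the face with \<open>e\<close> in its relative interior. If
  \<open>F\<close> had dimension at least two, its affine hull would meet the hyperplane in at least
  a line, along which \<open>e\<close> could move both ways inside the section. So \<open>F\<close>
  is a vertex or an edge, and an edge with an end on the hyperplane would lie in it
  entirely.\<close>

lemma extreme_point_of_polytope_Int_hyperplane:
  fixes P :: "'a::euclidean_space set"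
  assumes P: "polytope P" and e: "e extreme_point_of (P \<inter> {z. a \<bullet> z = \<beta>})"
  shows "e extreme_point_of P \<or>
    (\<exists>p q. closed_segment p q face_of P \<and> p \<noteq> q \<and> e \<in> open_segment p q \<and> a \<bullet> p < \<beta> \<and> \<beta> < a \<bullet> q)"
proof -
  have eP: "e \<in> P" "a \<bullet> e = \<beta>" using e by (auto simp: extreme_point_of_def)
  have nex: False if "x \<in> P" "y \<in> P" "a \<bullet> x = \<beta>" "a \<bullet> y = \<beta>" "e \<in> open_segment x y" for x y
    using e that by (auto simp: extreme_point_of_def)
  obtain F where F: "F face_of P" "e \<in> rel_interior F"
    using polytope_point_in_rel_interior_face[OF P eP(1)] by blast
  have eF: "e \<in> F" using F rel_interior_subset by blast
  have "aff_dim F \<le> 1"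
  proof (rule ccontr)
    assume "\<not> aff_dim F \<le> 1"
    moreover have "e \<in> affine hull F \<inter> {z. a \<bullet> z = \<beta>}"
      using eP(2) eF by (simp add: hull_inc)
    then have "affine hull F \<inter> {z. a \<bullet> z = \<beta>} \<noteq> {}" by blast
    then have "aff_dim (affine hull F \<inter> {z. a \<bullet> z = \<beta>}) \<ge> aff_dim F - 1"
      using aff_dim_affine_Int_hyperplane[OF affine_affine_hull, of F a \<beta>]
      by (simp split: if_split_asm)
    ultimately have "\<not> aff_dim (affine hull F \<inter> {z. a \<bullet> z = \<beta>}) \<le> aff_dim {e}"
      by simp
    then have "\<not> affine hull F \<inter> {z. a \<bullet> z = \<beta>} \<subseteq> {e}"
      using aff_dim_subset by blast
    then obtain z where z: "z \<in> affine hull F" "a \<bullet> z = \<beta>" "z \<noteq> e" by blast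
    obtain \<epsilon> where \<epsilon>: "\<epsilon> > 0" "e + \<epsilon> *\<^sub>R (z - e) \<in> F" "e - \<epsilon> *\<^sub>R (z - e) \<in> F"
      using rel_interior_extend[OF F(2) z(1)] by blast
    have "e = midpoint (e + \<epsilon> *\<^sub>R (z - e)) (e - \<epsilon> *\<^sub>R (z - e))"
      by (simp add: midpoint_def flip: scaleR_2)
    moreover have "e + \<epsilon> *\<^sub>R (z - e) \<noteq> e - \<epsilon> *\<^sub>R (z - e)"
    proof
      assume "e + \<epsilon> *\<^sub>R (z - e) = e - \<epsilon> *\<^sub>R (z - e)"
      then have "2 *\<^sub>R (\<epsilon> *\<^sub>R (z - e)) = 0"
        unfolding scaleR_2 by (metis add_left_cancel diff_conv_add_uminus add.right_inverse)
      then show False using \<epsilon>(1) z(3) by simp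
    qed
    ultimately have "e \<in> open_segment (e + \<epsilon> *\<^sub>R (z - e)) (e - \<epsilon> *\<^sub>R (z - e))"
      using midpoint_in_open_segment by metis
    moreover have "F \<subseteq> P" using F face_of_imp_subset by blast
    ultimately show False
      using nex[of "e + \<epsilon> *\<^sub>R (z - e)" "e - \<epsilon> *\<^sub>R (z - e)"] \<epsilon> z(2) eP(2)
      by (auto simp: inner_add_right inner_diff_right)
  qed
  moreover have "aff_dim F \<noteq> -1" using eF aff_dim_empty[of F] by auto
  ultimately consider "aff_dim F = 0" | "aff_dim F = 1"
    using aff_dim_geq[of F] by linarith
  then show ?thesis
  proof cases
    case 1
    then have "F = {e}" using aff_dim_eq_0[of F] eF by auto
    then show ?thesis using F face_of_singleton by metis
  next
    case 2
    have "polytope F" using F P face_of_polytope_polytope by blast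
    then have "compact F" "convex F" by (simp_all add: polytope_imp_compact polytope_imp_convex)
    moreover have "collinear F" "F \<noteq> {}" using 2 eF by (auto simp: collinear_aff_dim)
    ultimately obtain p q where pq: "F = closed_segment p q"
      using compact_convex_collinear_segment by metis
    have "p \<noteq> q" using 2 pq by auto
    then have eo: "e \<in> open_segment p q" using F pq rel_interior_closed_segment by metis
    then obtain u where u: "0 < u" "u < 1" "e = (1 - u) *\<^sub>R p + u *\<^sub>R q"
      by (auto simp: in_segment)
    have pP: "p \<in> P" "q \<in> P" using F(1) pq face_of_imp_subset by fastforce+
    have eq: "(1 - u) * (a \<bullet> p - \<beta>) + u * (a \<bullet> q - \<beta>) = 0"
      using eP(2) u by (simp add: inner_add_right algebra_simps)
    have "a \<bullet> p \<noteq> \<beta>"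
    proof
      assume "a \<bullet> p = \<beta>"
      moreover then have "a \<bullet> q = \<beta>" using eq u by simp
      ultimately show False using nex pP eo by blast
    qed
    moreover have "\<beta> < a \<bullet> q" if "a \<bullet> p < \<beta>"
    proof -
      have "(1 - u) * (a \<bullet> p - \<beta>) < 0" using u that by (simp add: mult_pos_neg)
      then have "0 < u * (a \<bullet> q - \<beta>)" using eq by linarith
      then show ?thesis using u by (simp add: zero_less_mult_iff)
    qed
    moreover have "a \<bullet> q < \<beta>" if "\<beta> < a \<bullet> p"
    proof -
      have "0 < (1 - u) * (a \<bullet> p - \<beta>)" using u that by simp
      then have "u * (a \<bullet> q - \<beta>) < 0" using eq by linarith
      then show ?thesis using u by (simp add: mult_less_0_iff)
    qed
    ultimately consider "a \<bullet> p < \<beta>" "\<beta> < a \<bullet> q" | "a \<bullet> q < \<beta>" "\<beta> < a \<bullet> p"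
      by linarith
    then show ?thesis
    proof cases
      case 1 then show ?thesis using F(1) pq \<open>p \<noteq> q\<close> eo by blast
    next
      case 2
      then show ?thesis using F(1) pq \<open>p \<noteq> q\<close> eo open_segment_commute closed_segment_commute by metis
    qed
  qed
qed

section \<open>Edges along which a linear functional improves\<close>

lemma polytope_extreme_point_above:
  fixes P :: "'a::euclidean_space set"
  assumes "polytope P" "y \<in> P" "r < c \<bullet> y"
  obtains u where "u extreme_point_of P" "r < c \<bullet> u"
proof (rule ccontr)
  assume "\<not> thesis"
  then have "{x. x extreme_point_of P} \<subseteq> {z. c \<bullet> z \<le> r}" using that by force
  then have "convex hull {x. x extreme_point_of P} \<subseteq> {z. c \<bullet> z \<le> r}"
    by (intro hull_minimal convex_halfspace_le)
  then show False
    using Krein_Milman_Minkowski[of P] assms polytope_imp_compact polytope_imp_convex by fastforce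
qed

lemma polytope_finite_extreme_points:
  fixes P :: "'a::euclidean_space set"
  shows "polytope P \<Longrightarrow> finite {x. x extreme_point_of P}"
  using finite_polyhedron_extreme_points polytope_imp_polyhedron by blast

text \<open>Cut off the vertex by a hyperplane and optimise over the vertex figure.\<close>

lemma polytope_improving_edge:
  fixes P :: "'a::euclidean_space set"
  assumes P: "polytope P" and v: "v extreme_point_of P" and y: "y \<in> P" "c \<bullet> v < c \<bullet> y"
  obtains w where "closed_segment v w face_of P" "c \<bullet> v < c \<bullet> w"
proof -
  have "{v} exposed_face_of P"
    using v exposed_face_of_polyhedron[OF polytope_imp_polyhedron[OF P]] face_of_singleton by blast
  then obtain a b where ab: "P \<subseteq> {x. a \<bullet> x \<le> b}" "{v} = P \<inter> {x. a \<bullet> x = b}"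
    by (auto simp: exposed_face_of_def)
  define W where "W = {w. w extreme_point_of P} - {v}"
  have fW: "finite W" using polytope_finite_extreme_points[OF P] by (simp add: W_def)
  obtain u where u: "u extreme_point_of P" "c \<bullet> v < c \<bullet> u"
    using polytope_extreme_point_above[OF P y] by blast
  then have uW: "u \<in> W" by (auto simp: W_def)
  have lt: "a \<bullet> w < b" if "w \<in> W" for w
  proof -
    have "w \<in> P" "w \<noteq> v" using that by (auto simp: W_def extreme_point_of_def)
    then show ?thesis using ab by force
  qed
  define m where "m = Max ((\<lambda>w. a \<bullet> w) ` W)"
  have "W \<noteq> {}" using uW by auto
  then have m: "m < b" "\<And>w. w \<in> W \<Longrightarrow> a \<bullet> w \<le> m"
    using fW lt by (simp_all add: m_def)
  \<comment> \<open>The hyperplane at level \<open>\<beta>\<close> separates \<open>v\<close> from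
    all other vertices of \<open>P\<close>.\<close>
  define \<beta> where "\<beta> = (m + b) / 2"
  have "m < \<beta>" using m(1) by (simp add: \<beta>_def)
  then have \<beta>: "\<beta> < b" "\<And>w. w \<in> W \<Longrightarrow> a \<bullet> w < \<beta>"
    using m by (auto simp: \<beta>_def[symmetric] intro: le_less_trans) (simp add: \<beta>_def)
  have av: "a \<bullet> v = b" "v \<in> P" using ab(2) by auto
  \<comment> \<open>Parameter at which the segment from \<open>v\<close> to the better vertex
    \<open>u\<close> meets the cutting hyperplane.\<close>
  define t where "t = (b - \<beta>) / (b - a \<bullet> u)"
  have t: "0 < t" "t < 1" using \<beta>(1) \<beta>(2)[OF uW] by (auto simp: t_def field_simps)
  define y' where "y' = (1 - t) *\<^sub>R v + t *\<^sub>R u"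
  have "a \<bullet> y' = b - t * (b - a \<bullet> u)" by (simp add: y'_def inner_add_right av algebra_simps)
  also have "\<dots> = \<beta>" using lt[OF uW] by (simp add: t_def)
  finally have ay: "a \<bullet> y' = \<beta>" .
  have "y' \<in> P"
    unfolding y'_def using t av(2) u(1) P
    by (intro convexD polytope_imp_convex) (auto simp: extreme_point_of_def)
  have "c \<bullet> y' = c \<bullet> v + t * (c \<bullet> u - c \<bullet> v)"
    by (simp add: y'_def inner_add_right algebra_simps)
  then have cy: "c \<bullet> v < c \<bullet> y'" using t u(2) by simp
  have "polytope (P \<inter> {z. a \<bullet> z = \<beta>})"
    by (simp add: P polytope_Int_polyhedron polyhedron_hyperplane)
  then obtain e where e: "e extreme_point_of (P \<inter> {z. a \<bullet> z = \<beta>})" "c \<bullet> v < c \<bullet> e"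
    using polytope_extreme_point_above[of _ y' "c \<bullet> v" c] cy ay \<open>y' \<in> P\<close> by blast
  have "a \<bullet> e = \<beta>" using e by (auto simp: extreme_point_of_def)
  then have "\<not> e extreme_point_of P"
    using \<beta> av by (cases "e = v") (auto simp: W_def)
  then obtain p q where pq: "closed_segment p q face_of P" "e \<in> open_segment p q" "\<beta> < a \<bullet> q"
    using extreme_point_of_polytope_Int_hyperplane[OF P e(1)] by blast
  \<comment> \<open>Only \<open>v\<close> lies above the level \<open>\<beta>\<close>, so every edge
    through the cut starts at \<open>v\<close>. As \<open>e\<close> lies between \<open>p\<close>
    and \<open>v\<close> and beats \<open>v\<close>, so does \<open>p\<close>.\<close>
  have "q = v"
  proof (rule ccontr)
    assume "q \<noteq> v"
    then have "q \<in> W" using segment_face_of(2)[OF pq(1)] by (auto simp: W_def)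
    then show False using \<beta>(2) pq(3) by force
  qed
  obtain s where s: "0 < s" "s < 1" "e = (1 - s) *\<^sub>R p + s *\<^sub>R v"
    using pq(2) \<open>q = v\<close> by (auto simp: in_segment)
  have "(1 - s) * (c \<bullet> v) < (1 - s) * (c \<bullet> p)"
    using e(2) s by (simp add: inner_add_right algebra_simps)
  then have "c \<bullet> v < c \<bullet> p" using s by simp
  moreover have "closed_segment v p face_of P"
    using pq(1) \<open>q = v\<close> by (simp add: closed_segment_commute)
  ultimately show ?thesis using that by blast
qed

text \<open>A segment determines its pair of ends, so two distinct points can be charged to the same
  segment only if \<open>f\<close> swaps them.\<close>

lemma card_le_card_segments:
  fixes f :: "'a::euclidean_space \<Rightarrow> 'a"
  assumes "finite \<E>" "\<And>v. v \<in> A \<Longrightarrow> closed_segment v (f v) \<in> \<E>"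
    "\<And>v. v \<in> A \<Longrightarrow> f v \<in> A \<Longrightarrow> f (f v) \<noteq> v"
  shows "card A \<le> card \<E>"
proof (rule card_inj_on_le)
  show "inj_on (\<lambda>v. closed_segment v (f v)) A"
  proof (rule inj_onI, rule ccontr)
    fix u v assume uv: "u \<in> A" "v \<in> A" "closed_segment u (f u) = closed_segment v (f v)" "u \<noteq> v"
    then have "{u, f u} = {v, f v}" by (simp add: closed_segment_eq)
    then have "f u = v" "f v = u" using uv(4) by (auto simp: doubleton_eq_iff)
    then show False using assms(3)[of u] uv by auto
  qed
qed (use assms in auto)

lemma aff_dim_closed_segment: "a \<noteq> b \<Longrightarrow> aff_dim (closed_segment a b) = 1"
  by (simp add: segment_convex_hull aff_dim_convex_hull)

lemma card_vertices_ge: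
  fixes P :: "'a::euclidean_space set"
  assumes "polytope P" "interior P \<noteq> {}"
  shows "DIM('a) + 1 \<le> card {v. v extreme_point_of P}"
proof -
  have "int DIM('a) = aff_dim P" using assms(2) aff_dim_nonempty_interior by metis
  also have "\<dots> = aff_dim {v. v extreme_point_of P}"
    using Krein_Milman_Minkowski[of P] aff_dim_convex_hull polytope_imp_compact[OF assms(1)]
      polytope_imp_convex[OF assms(1)] by metis
  also have "\<dots> \<le> int (card {v. v extreme_point_of P}) - 1"
    by (rule aff_dim_le_card[OF polytope_finite_extreme_points[OF assms(1)]])
  finally show ?thesis by linarith
qed

section \<open>Counting edges and crossing edges\<close>

definition crossing_edges :: "'a::euclidean_space set \<Rightarrow> 'a \<Rightarrow> 'a set set" where
  "crossing_edges P x =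
     {E. E face_of P \<and> aff_dim E = 1 \<and> (\<exists>p q. E = closed_segment p q \<and> x \<bullet> p < 0 \<and> 0 < x \<bullet> q)}"

lemma finite_polytope_edges:
  fixes P :: "'a::euclidean_space set"
  assumes "polytope P"
  shows "finite {E. E face_of P \<and> aff_dim E = 1}"
  using finite_polytope_faces[OF assms] by (rule rev_finite_subset) auto

text \<open>\<open>m\<close> maximises \<open>c\<close> over the vertices. By injectivity every
  other vertex is strictly worse, hence has an improving edge.\<close>

lemma polytope_optimal_vertex:
  fixes P :: "'a::euclidean_space set"
  assumes P: "polytope P" and inj: "inj_on ((\<bullet>) c) {v. v extreme_point_of P}"
    and ne: "P \<noteq> {}"
  obtains m where "m extreme_point_of P"
    "\<And>v. v extreme_point_of P \<Longrightarrow> v \<noteq> m \<Longrightarrow> \<exists>w. closed_segment v w face_of P \<and> c \<bullet> v < c \<bullet> w"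
proof -
  define V where "V = {v. v extreme_point_of P}"
  have fin: "finite V" unfolding V_def by (rule polytope_finite_extreme_points[OF P])
  have "V \<noteq> {}"
    unfolding V_def using extreme_point_exists_convex[OF polytope_imp_compact[OF P] polytope_imp_convex[OF P] ne]
    by blast
  then have "Max ((\<bullet>) c ` V) \<in> (\<bullet>) c ` V" using fin by simp
  then obtain m where m': "m \<in> V" "Max ((\<bullet>) c ` V) = c \<bullet> m" by blast
  have m: "m \<in> V" "\<And>v. v \<in> V \<Longrightarrow> c \<bullet> v \<le> c \<bullet> m"
    using m' fin by (auto simp: m'(2)[symmetric])
  have "\<exists>w. closed_segment v w face_of P \<and> c \<bullet> v < c \<bullet> w" if v: "v extreme_point_of P" "v \<noteq> m" for v
  proof -
    have "c \<bullet> v \<noteq> c \<bullet> m" using inj v m(1) by (auto simp: inj_on_def V_def)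
    then have "c \<bullet> v < c \<bullet> m" using m(2)[of v] v(1) by (simp add: V_def)
    moreover have "m \<in> P" using m(1) by (simp add: V_def extreme_point_of_def)
    ultimately show ?thesis using polytope_improving_edge[OF P v(1)] by metis
  qed
  then show ?thesis using that m(1) by (auto simp: V_def)
qed

text \<open>Charge each vertex but the best one to an improving edge; \<open>c\<close> strictly
  increases along \<open>f\<close>, so no edge is charged twice. The bound makes
  \<open>num_edges P - (CARD('n) - 1)\<close> positive.\<close>

lemma card_edges_ge_DIM:
  fixes P :: "'a::euclidean_space set"
  assumes P: "polytope P" and i: "interior P \<noteq> {}"
    and inj: "inj_on ((\<bullet>) c) {v. v extreme_point_of P}"
  shows "DIM('a) \<le> card {E. E face_of P \<and> aff_dim E = 1}"
proof -
  define V where "V = {v. v extreme_point_of P}"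
  have ne: "P \<noteq> {}" using i by auto
  obtain m where m: "m extreme_point_of P"
    "\<And>v. v extreme_point_of P \<Longrightarrow> v \<noteq> m \<Longrightarrow> \<exists>w. closed_segment v w face_of P \<and> c \<bullet> v < c \<bullet> w"
    using polytope_optimal_vertex[OF P inj ne] by blast
  then obtain f where f: "\<And>v. v \<in> V - {m} \<Longrightarrow> closed_segment v (f v) face_of P \<and> c \<bullet> v < c \<bullet> f v"
    unfolding V_def by (metis (no_types, lifting) DiffE mem_Collect_eq singletonI)
  have "card (V - {m}) \<le> card {E. E face_of P \<and> aff_dim E = 1}"
  proof (rule card_le_card_segments[where f = f])
    show "closed_segment v (f v) \<in> {E. E face_of P \<and> aff_dim E = 1}" if "v \<in> V - {m}" for v
      using f[OF that] aff_dim_closed_segment[of v "f v"] by (cases "v = f v") auto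
    show "f (f v) \<noteq> v" if "v \<in> V - {m}" "f v \<in> V - {m}" for v
      using f[OF that(1)] f[OF that(2)] by auto
  qed (rule finite_polytope_edges[OF P])
  moreover have "card (V - {m}) = card V - 1"
    using m(1) by (simp add: V_def card_Diff_singleton)
  ultimately show ?thesis using card_vertices_ge[OF P i] by (simp add: V_def)
qed

text \<open>Every vertex except the two optimal ones is the start of an edge that moves away from the
  hyperplane, and these edges do not cross it.\<close>

lemma card_crossing_edges_le:
  fixes P :: "'a::euclidean_space set"
  assumes P: "polytope P" and i: "interior P \<noteq> {}"
    and inj: "inj_on ((\<bullet>) c) {v. v extreme_point_of P}"
  shows "card (crossing_edges P c) + (DIM('a) - 1) \<le> card {E. E face_of P \<and> aff_dim E = 1}"
proof -
  define V where "V = {v. v extreme_point_of P}"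
  define \<E> where "\<E> = {E. E face_of P \<and> aff_dim E = 1}"
  have finE: "finite \<E>" unfolding \<E>_def by (rule finite_polytope_edges[OF P])
  have ne: "P \<noteq> {}" using i by auto
  have inj': "inj_on ((\<bullet>) (- c)) {v. v extreme_point_of P}"
    using inj by (auto simp: inj_on_def)
  obtain m where m: "m extreme_point_of P"
    "\<And>v. v extreme_point_of P \<Longrightarrow> v \<noteq> m \<Longrightarrow> \<exists>w. closed_segment v w face_of P \<and> c \<bullet> v < c \<bullet> w"
    using polytope_optimal_vertex[OF P inj ne] by blast
  obtain l where l: "l extreme_point_of P"
    "\<And>v. v extreme_point_of P \<Longrightarrow> v \<noteq> l \<Longrightarrow> \<exists>w. closed_segment v w face_of P \<and> (- c) \<bullet> v < (- c) \<bullet> w"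
    using polytope_optimal_vertex[OF P inj' ne] by blast
  define A where "A = V - {m, l}"
  \<comment> \<open>Vertices at nonnegative height move up and the others move down, so both optimal
    vertices have to be left out.\<close>
  have "\<exists>w. closed_segment v w face_of P \<and>
      (if 0 \<le> c \<bullet> v then c \<bullet> v < c \<bullet> w else c \<bullet> w < c \<bullet> v)" if "v \<in> A" for v
    using m(2)[of v] l(2)[of v] that by (auto simp: A_def V_def)
  then obtain f where f: "\<And>v. v \<in> A \<Longrightarrow> closed_segment v (f v) face_of P"
    "\<And>v. v \<in> A \<Longrightarrow> if 0 \<le> c \<bullet> v then c \<bullet> v < c \<bullet> f v else c \<bullet> f v < c \<bullet> v"
    by metis
  have "card A \<le> card (\<E> - crossing_edges P c)"
  proof (rule card_le_card_segments[where f = f])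
    show "closed_segment v (f v) \<in> \<E> - crossing_edges P c" if v: "v \<in> A" for v
    proof
      have "v \<noteq> f v" using f(2)[OF v] by (metis less_irrefl)
      then show "closed_segment v (f v) \<in> \<E>"
        using f(1)[OF v] aff_dim_closed_segment by (auto simp: \<E>_def)
      show "closed_segment v (f v) \<notin> crossing_edges P c"
      proof
        assume "closed_segment v (f v) \<in> crossing_edges P c"
        then obtain p q where pq: "{v, f v} = {p, q}" "c \<bullet> p < 0" "0 < c \<bullet> q"
          by (auto simp: crossing_edges_def closed_segment_eq)
        then have "c \<bullet> v < 0 \<and> 0 < c \<bullet> f v \<or> c \<bullet> f v < 0 \<and> 0 < c \<bullet> v"
          by (auto simp: doubleton_eq_iff)
        then show False using f(2)[OF v] by (auto split: if_splits)
      qed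
    qed
    \<comment> \<open>\<open>f\<close> stays on the same side of the hyperplane and moves strictly
      away from it, so it never returns.\<close>
    show "f (f v) \<noteq> v" if "v \<in> A" "f v \<in> A" for v
      using f(2)[OF that(1)] f(2)[OF that(2)] by (auto split: if_splits)
  qed (use finE in auto)
  moreover have "card V - 2 \<le> card A"
  proof -
    have "card V - card {m, l} \<le> card A"
      unfolding A_def by (rule diff_card_le_card_Diff) auto
    moreover have "card {m, l} \<le> 2" by (simp add: card_insert_if)
    ultimately show ?thesis by linarith
  qed
  moreover have "crossing_edges P c \<subseteq> \<E>" by (auto simp: crossing_edges_def \<E>_def)
  then have "card (\<E> - crossing_edges P c) = card \<E> - card (crossing_edges P c)"
    "card (crossing_edges P c) \<le> card \<E>"
    using finE by (simp_all add: card_Diff_subset finite_subset card_mono)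
  ultimately show ?thesis
    using card_vertices_ge[OF P i] unfolding V_def[symmetric] \<E>_def[symmetric] by linarith
qed

text \<open>The functionals that identify two given points form a hyperplane, and finitely many
  hyperplanes form a null set.\<close>

lemma exists_injective_functional:
  fixes V :: "'a::euclidean_space set"
  assumes "finite V"
  obtains c where "inj_on ((\<bullet>) c) V"
proof -
  have "negligible (\<Union>p\<in>{p\<in>V \<times> V. fst p \<noteq> snd p}. {c. (fst p - snd p) \<bullet> c = 0})"
    using assms by (intro negligible_Union) (auto intro!: negligible_hyperplane)
  then have "(\<Union>p\<in>{p\<in>V \<times> V. fst p \<noteq> snd p}. {c. (fst p - snd p) \<bullet> c = 0}) \<noteq> UNIV"
    using non_negligible_UNIV by metis
  then obtain c where c: "c \<notin> (\<Union>p\<in>{p\<in>V \<times> V. fst p \<noteq> snd p}. {c. (fst p - snd p) \<bullet> c = 0})" by blast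
  have "inj_on ((\<bullet>) c) V"
  proof (rule inj_onI, rule ccontr)
    fix u v assume "u \<in> V" "v \<in> V" "c \<bullet> u = c \<bullet> v" "u \<noteq> v"
    then show False using c by (auto simp: inner_diff_left inner_commute[of _ c])
  qed
  then show ?thesis by (rule that)
qed

subsection \<open>Continuity of the section volume\<close>

definition prism :: "'a::euclidean_space set \<Rightarrow> 'a \<Rightarrow> 'a set" where
  "prism S n = {y + t *\<^sub>R n | y t. y \<in> S \<and> t \<in> {0..1}}"

lemma section_volume_eq_prism:
  "section_volume P x = measure lebesgue (prism (P \<inter> {y. x \<bullet> y = 0}) (sgn x))"
  by (simp add: section_volume_def prism_def sgn_div_norm conj_assoc)

text \<open>For a unit vector \<open>n\<close>, the height of \<open>z\<close> is
  \<open>n \<bullet> z\<close> and its foot is \<open>z - (n \<bullet> z) *\<^sub>R n\<close>.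
  Membership becomes a condition on functions continuous in \<open>n\<close>, which allows limits in
  \<open>n\<close>.\<close>

lemma prism_hyperplane_eq:
  assumes "norm n = 1"
  shows "prism (P \<inter> {y. n \<bullet> y = 0}) n = {z. z - (n \<bullet> z) *\<^sub>R n \<in> P \<and> n \<bullet> z \<in> {0..1}}"
proof -
  have nn: "n \<bullet> n = 1" using assms by (simp add: norm_eq_1)
  show ?thesis
  proof (intro equalityI subsetI)
    fix z assume "z \<in> {z. z - (n \<bullet> z) *\<^sub>R n \<in> P \<and> n \<bullet> z \<in> {0..1}}"
    then show "z \<in> prism (P \<inter> {y. n \<bullet> y = 0}) n"
      unfolding prism_def using nn
      by (intro CollectI exI[of _ "z - (n \<bullet> z) *\<^sub>R n"] exI[of _ "n \<bullet> z"])
        (auto simp: inner_diff_right)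
  qed (auto simp: prism_def inner_add_right nn)
qed

lemma prism_hyperplane_sgn:
  fixes x :: "'a::euclidean_space"
  assumes "x \<noteq> 0"
  shows "prism (P \<inter> {y. x \<bullet> y = 0}) (sgn x) = {z. z - (sgn x \<bullet> z) *\<^sub>R sgn x \<in> P \<and> sgn x \<bullet> z \<in> {0..1}}"
proof -
  have "{y. x \<bullet> y = 0} = {y. sgn x \<bullet> y = 0}" using assms by (auto simp: sgn_div_norm)
  then show ?thesis using prism_hyperplane_eq[of "sgn x" P] assms by (simp add: norm_sgn)
qed

text \<open>The foot \<open>g\<close> of \<open>z\<close> can be pushed a little further away from
  \<open>p\<close> without leaving \<open>P\<close>. Shrinking the pushed point towards the interior
  point \<open>p\<close> leads back to \<open>g\<close> and lands in the interior.\<close>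

lemma interior_prism_section:
  fixes P :: "'a::euclidean_space set"
  assumes n: "norm n = 1" and P: "convex P" and p: "p \<in> interior P" "n \<bullet> p = 0"
    and z: "z \<in> interior {z. z - (n \<bullet> z) *\<^sub>R n \<in> P \<and> n \<bullet> z \<in> {0..1}}"
  shows "z - (n \<bullet> z) *\<^sub>R n \<in> interior P" "0 < n \<bullet> z" "n \<bullet> z < 1"
proof -
  let ?K = "{z. z - (n \<bullet> z) *\<^sub>R n \<in> P \<and> n \<bullet> z \<in> {0..1}}"
  have nn: "n \<bullet> n = 1" using n by (simp add: norm_eq_1)
  obtain r where r: "r > 0" "cball z r \<subseteq> ?K"
    using z mem_interior_cball by blast
  have "z + r *\<^sub>R n \<in> cball z r" "z - r *\<^sub>R n \<in> cball z r"
    using r(1) n by (auto simp: dist_norm)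
  then have "z + r *\<^sub>R n \<in> ?K" "z - r *\<^sub>R n \<in> ?K" using r(2) by blast+
  then have "n \<bullet> (z + r *\<^sub>R n) \<le> 1" "0 \<le> n \<bullet> (z - r *\<^sub>R n)" by auto
  then show "0 < n \<bullet> z" "n \<bullet> z < 1"
    using r(1) by (auto simp: inner_add_right inner_diff_right nn)
  define g where "g = z - (n \<bullet> z) *\<^sub>R n"
  define s where "s = r / (1 + norm (g - p))"
  have np: "1 + norm (g - p) > 0" by (smt (verit) norm_ge_zero)
  have s: "s > 0" "s * norm (g - p) \<le> r" using r(1) np by (auto simp: s_def field_simps)
  have ng: "n \<bullet> g = 0" by (simp add: g_def inner_diff_right nn)
  have "z + s *\<^sub>R (g - p) \<in> cball z r" using s by (simp add: dist_norm)
  then have "z + s *\<^sub>R (g - p) - (n \<bullet> (z + s *\<^sub>R (g - p))) *\<^sub>R n \<in> P" using r(2) by blast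
  then have gP: "g + s *\<^sub>R (g - p) \<in> P"
    using p(2) ng by (simp add: g_def[symmetric] inner_add_right inner_diff_right algebra_simps)
      (simp add: g_def algebra_simps)
  \<comment> \<open>The shrinking factor that takes \<open>g + s *\<^sub>R (g - p)\<close> back to
    exactly \<open>g\<close>.\<close>
  define e where "e = s / (1 + s)"
  have "(g + s *\<^sub>R (g - p)) - e *\<^sub>R ((g + s *\<^sub>R (g - p)) - p) \<in> interior P"
    by (rule mem_interior_convex_shrink[OF P p(1) gP]) (use s in \<open>auto simp: e_def\<close>)
  moreover have "(g + s *\<^sub>R (g - p)) - p = (1 + s) *\<^sub>R (g - p)" by (simp add: algebra_simps)
  moreover have "e * (1 + s) = s" using s by (simp add: e_def)
  ultimately show "z - (n \<bullet> z) *\<^sub>R n \<in> interior P" by (simp add: g_def[symmetric])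
qed

text \<open>Dominated convergence of indicator functions, with a common ball as the bound. Off the
  prism and, if the hyperplane meets the interior of \<open>P\<close>, inside its interior,
  membership is governed by open conditions and is stable under small changes of \<open>n\<close>.
  What remains is a null set.\<close>

lemma tendsto_measure_section_prism:
  fixes P :: "'a::euclidean_space set"
  assumes P: "compact P" "convex P" and n: "norm n = 1"
    and N: "N \<longlonglongrightarrow> n" "\<And>k. norm (N k) \<le> 1"
    and alt: "(\<exists>p\<in>interior P. n \<bullet> p = 0) \<or>
      negligible {z. z - (n \<bullet> z) *\<^sub>R n \<in> P \<and> n \<bullet> z \<in> {0..1}}"
  shows "(\<lambda>k. measure lebesgue {z. z - (N k \<bullet> z) *\<^sub>R N k \<in> P \<and> N k \<bullet> z \<in> {0..1}})
    \<longlonglongrightarrow> measure lebesgue {z. z - (n \<bullet> z) *\<^sub>R n \<in> P \<and> n \<bullet> z \<in> {0..1}}"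
proof -
  define K where "K = (\<lambda>n. {z. z - (n \<bullet> z) *\<^sub>R n \<in> P \<and> n \<bullet> z \<in> {0..1}})"
  have clP: "closed P" using P(1) compact_imp_closed by blast
  have clK: "closed (K m)" for m
  proof -
    have "closed ((\<lambda>z. z - (m \<bullet> z) *\<^sub>R m) -` P \<inter> (\<lambda>z. m \<bullet> z) -` {0..1})"
      by (intro closed_Int closed_vimage clP continuous_intros)
    moreover have "(\<lambda>z. z - (m \<bullet> z) *\<^sub>R m) -` P \<inter> (\<lambda>z. m \<bullet> z) -` {0..1} = K m"
      by (auto simp: K_def)
    ultimately show ?thesis by simp
  qed
  have setsK: "K m \<in> sets lebesgue" for m using clK[of m] by auto
  obtain B where B: "\<And>z. z \<in> P \<Longrightarrow> norm z \<le> B"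
    using compact_imp_bounded[OF P(1)] by (auto simp: bounded_iff)
  have bound: "norm z \<le> B + 1" if "z \<in> K m" "norm m \<le> 1" for z m
  proof -
    have "norm ((m \<bullet> z) *\<^sub>R m) \<le> 1 * 1"
      unfolding norm_scaleR using that by (intro mult_mono) (auto simp: K_def)
    moreover have "norm (z - (m \<bullet> z) *\<^sub>R m) \<le> B" using that B by (auto simp: K_def)
    ultimately show ?thesis using norm_triangle_sub[of z "(m \<bullet> z) *\<^sub>R m"] by simp
  qed
  have "convex (K n)"
  proof -
    have lin: "linear (\<lambda>z. z - (n \<bullet> z) *\<^sub>R n)"
      by (intro linearI) (auto simp: inner_add_right algebra_simps)
    have "convex ((\<lambda>z. z - (n \<bullet> z) *\<^sub>R n) -` P \<inter> ({z. 0 \<le> n \<bullet> z} \<inter> {z. n \<bullet> z \<le> 1}))"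
      by (intro convex_Int convex_linear_vimage lin P convex_halfspace_le convex_halfspace_ge)
    moreover have "(\<lambda>z. z - (n \<bullet> z) *\<^sub>R n) -` P \<inter> ({z. 0 \<le> n \<bullet> z} \<inter> {z. n \<bullet> z \<le> 1}) = K n"
      by (auto simp: K_def)
    ultimately show ?thesis by simp
  qed
  then have fr: "negligible (frontier (K n))" by (rule negligible_convex_frontier)
  \<comment> \<open>The exceptional set: the boundary of a convex set, or the whole limit prism when
    the hyperplane misses the interior of \<open>P\<close>.\<close>
  define Z where "Z = (if \<exists>p\<in>interior P. n \<bullet> p = 0 then frontier (K n) else K n)"
  have Z: "Z \<in> null_sets lebesgue"
    using fr alt by (auto simp: Z_def K_def negligible_iff_null_sets)
  have conv: "(\<lambda>k. indicat_real (K (N k)) z) \<longlonglongrightarrow> indicat_real (K n) z" if "z \<notin> Z" for z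
  proof -
    have t1: "(\<lambda>k. z - (N k \<bullet> z) *\<^sub>R N k) \<longlonglongrightarrow> z - (n \<bullet> z) *\<^sub>R n"
      by (intro tendsto_intros N)
    have t2: "(\<lambda>k. N k \<bullet> z) \<longlonglongrightarrow> n \<bullet> z" by (intro tendsto_intros N)
    have "\<forall>\<^sub>F k in sequentially. indicat_real (K (N k)) z = indicat_real (K n) z"
    proof (cases "z \<in> K n")
      case False
      then consider "z - (n \<bullet> z) *\<^sub>R n \<in> - P" | "n \<bullet> z < 0" | "1 < n \<bullet> z"
        by (force simp: K_def)
      then have "\<forall>\<^sub>F k in sequentially. z \<notin> K (N k)"
      proof cases
        case 1
        then show ?thesis using topological_tendstoD[OF t1, of "- P"] clP
          by (auto simp: K_def open_Compl elim!: eventually_mono)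
      next
        case 2
        show ?thesis using order_tendstoD(2)[OF t2 2] by (auto simp: K_def elim!: eventually_mono)
      next
        case 3
        show ?thesis using order_tendstoD(1)[OF t2 3] by (auto simp: K_def elim!: eventually_mono)
      qed
      then show ?thesis using False by (auto elim!: eventually_mono)
    next
      case True
      then obtain p where p: "p \<in> interior P" "n \<bullet> p = 0" "z \<notin> frontier (K n)"
        using \<open>z \<notin> Z\<close> by (auto simp: Z_def split: if_splits)
      then have "z \<in> interior (K n)" using True closure_subset by (auto simp: frontier_def)
      note i = interior_prism_section[OF n P(2) p(1,2) this[unfolded K_def]]
      have "\<forall>\<^sub>F k in sequentially. z \<in> K (N k)"
        using topological_tendstoD[OF t1 open_interior i(1)] order_tendstoD(1)[OF t2 i(2)]
          order_tendstoD(2)[OF t2 i(3)]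
      proof eventually_elim
        case (elim k)
        then show ?case using interior_subset[of P] by (auto simp: K_def)
      qed
      then show ?thesis using True by (auto elim!: eventually_mono)
    qed
    then show ?thesis by (rule tendsto_eventually)
  qed
  have "(\<lambda>k. integral\<^sup>L lebesgue (indicat_real (K (N k)))) \<longlonglongrightarrow> integral\<^sup>L lebesgue (indicat_real (K n))"
  proof (rule integral_dominated_convergence[where w = "indicat_real (cball 0 (B + 1))"])
    show "AE z in lebesgue. (\<lambda>k. indicat_real (K (N k)) z) \<longlonglongrightarrow> indicat_real (K n) z"
      by (rule AE_I'[OF Z]) (use conv in blast)
    show "integrable lebesgue (indicat_real (cball 0 (B + 1)) :: 'a \<Rightarrow> real)"
      using lmeasurable_cball[of "0::'a" "B + 1"] by (simp add: fmeasurable_def integrable_indicator_iff)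
    show "AE z in lebesgue. norm (indicat_real (K (N k)) z) \<le> indicat_real (cball 0 (B + 1)) z" for k
      using bound[OF _ N(2)[of k]] by (auto simp: indicator_def)
  qed (use setsK in auto)
  then show ?thesis by (simp add: K_def)
qed

text \<open>Away from the origin the section volume is a function of \<open>sgn y\<close>, so the
  limit theorem for unit normals applies along every sequence.\<close>

lemma isCont_section_volume:
  fixes P :: "(real^'n) set"
  assumes P: "compact P" "convex P" and x: "x \<noteq> 0"
    and alt: "(\<exists>p\<in>interior P. x \<bullet> p = 0) \<or> negligible (prism (P \<inter> {y. x \<bullet> y = 0}) (sgn x))"
  shows "isCont (section_volume P) x"
proof -
  define M where "M = (\<lambda>n. measure lebesgue {z. z - (n \<bullet> z) *\<^sub>R n \<in> P \<and> n \<bullet> z \<in> {0..1}})"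
  have sv: "section_volume P y = M (sgn y)" if "y \<noteq> 0" for y
    using that by (simp add: section_volume_eq_prism prism_hyperplane_sgn M_def)
  have alt': "(\<exists>p\<in>interior P. sgn x \<bullet> p = 0) \<or>
      negligible {z. z - (sgn x \<bullet> z) *\<^sub>R sgn x \<in> P \<and> sgn x \<bullet> z \<in> {0..1}}"
    using alt unfolding prism_hyperplane_sgn[OF x] by (auto simp: sgn_div_norm)
  have "isCont (\<lambda>y. M (sgn y)) x"
    unfolding continuous_at_sequentially
  proof (intro allI impI)
    fix X :: "nat \<Rightarrow> real^'n" assume "X \<longlonglongrightarrow> x"
    then have "(\<lambda>k. sgn (X k)) \<longlonglongrightarrow> sgn x" using x by (intro tendsto_sgn)
    \<comment> \<open>The sequence may pass through the origin, where \<open>sgn\<close> is 0; a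
      norm of at most 1 still holds there.\<close>
    from tendsto_measure_section_prism[OF P _ this _ alt'] x
    show "((\<lambda>y. M (sgn y)) \<circ> X) \<longlonglongrightarrow> M (sgn x)"
      by (simp add: o_def M_def norm_sgn)
  qed
  moreover have "\<forall>\<^sub>F y in nhds x. section_volume P y = M (sgn y)"
    using eventually_nhds_in_open[OF open_Compl[OF closed_singleton], of x 0] x
    by (auto simp: sv elim!: eventually_mono)
  ultimately show ?thesis using isCont_cong by fastforce
qed

subsection \<open>Volumes of prisms over simplices\<close>

text \<open>The library proves this only for well-ordered index types; there the order serves to compute
  the determinant of a shear, which here comes from a row operation on the identity.\<close>

lemma measure_linear_image_det:
  fixes f :: "real^'n \<Rightarrow> real^'n"
  assumes "linear f" "S \<in> lmeasurable"
  shows "f ` S \<in> lmeasurable \<and> measure lebesgue (f ` S) = \<bar>det (matrix f)\<bar> * measure lebesgue S"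
proof -
  let ?Q = "\<lambda>f :: real^'n \<Rightarrow> real^'n. \<forall>S\<in>lmeasurable.
    f ` S \<in> lmeasurable \<and> measure lebesgue (f ` S) = \<bar>det (matrix f)\<bar> * measure lebesgue S"
  have "?Q f"
  proof (rule induct_linear_elementary[OF assms(1)])
    fix f g :: "real^'n \<Rightarrow> real^'n" assume fg: "linear f" "linear g" "?Q f" "?Q g"
    show "?Q (f \<circ> g)"
    proof
      fix S :: "(real^'n) set" assume "S \<in> lmeasurable"
      moreover have "(f \<circ> g) ` S = f ` (g ` S)" by (simp add: image_comp)
      ultimately show "(f \<circ> g) ` S \<in> lmeasurable \<and>
          measure lebesgue ((f \<circ> g) ` S) = \<bar>det (matrix (f \<circ> g))\<bar> * measure lebesgue S"
        using fg by (simp add: matrix_compose det_mul abs_mult)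
    qed
  next
    fix f :: "real^'n \<Rightarrow> real^'n" and i assume f: "linear f" "\<And>x. f x $ i = 0"
    have "\<not> surj f"
      using f(2) by (metis one_neq_zero surjD vec_component)
    then have ni: "\<not> inj f" using linear_injective_imp_surjective[OF f(1)] by blast
    then have "negligible (f ` S)" for S by (rule negligible_linear_singular_image[OF f(1)])
    moreover have "det (matrix f) = 0" using ni det_nz_iff_inj[OF f(1)] by blast
    ultimately show "?Q f" by (simp add: negligible_iff_measure)
  next
    fix c :: "'n \<Rightarrow> real"
    have "det (matrix (\<lambda>x :: real^'n. \<chi> i. c i * x $ i)) = prod c UNIV"
      by (subst det_diagonal) (auto simp: matrix_def axis_def)
    then show "?Q (\<lambda>x. \<chi> i. c i * x $ i)" by (simp add: measurable_stretch measure_stretch)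
  next
    fix m n :: 'n assume "m \<noteq> n"
    \<comment> \<open>A transposition of coordinates permutes the side lengths of a box, and its
      determinant is a sign, which the absolute value removes.\<close>
    let ?t = "Transposition.transpose m n"
    let ?h = "\<lambda>x :: real^'n. \<chi> i. x $ ?t i"
    have lin: "linear ?h" by (rule linearI) (simp_all add: vec_eq_iff)
    have perm: "?t permutes UNIV" by (simp add: permutes_swap_id)
    have "matrix ?h = (\<chi> i. mat 1 $ ?t i)"
      by (auto simp: matrix_def vec_eq_iff mat_def axis_def)
    then have det: "\<bar>det (matrix ?h)\<bar> = 1"
      by (simp add: det_permute_rows[OF perm] sign_swap_id abs_mult)
    have box: "?h ` cbox a b = cbox (?h a) (?h b)" for a b
    proof (intro equalityI subsetI)
      fix y assume y: "y \<in> cbox (?h a) (?h b)"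
      have "a $ i \<le> y $ ?t i \<and> y $ ?t i \<le> b $ i" for i
      proof -
        have "\<forall>j. a $ ?t j \<le> y $ j \<and> y $ j \<le> b $ ?t j"
          using y by (simp add: mem_box_cart)
        from this[rule_format, of "?t i"] show ?thesis by simp
      qed
      then have "?h y \<in> cbox a b" by (simp add: mem_box_cart)
      moreover have "y = ?h (?h y)" by (simp add: vec_eq_iff)
      ultimately show "y \<in> ?h ` cbox a b" by (rule rev_image_eqI)
    qed (auto simp: mem_box_cart)
    have im: "measure lebesgue (?h ` cbox a b) = 1 * measure lebesgue (cbox a b)" for a b
    proof (cases "cbox a b = {}")
      case False
      then have "cbox (?h a) (?h b) \<noteq> {}" using box by (metis image_is_empty)
      moreover have "(\<Prod>i\<in>UNIV. b $ ?t i - a $ ?t i) = (\<Prod>i\<in>UNIV. b $ i - a $ i)"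
        using prod.permute[OF perm, of "\<lambda>i. b $ i - a $ i"] by (simp add: o_def)
      ultimately show ?thesis using False by (simp add: box content_cbox_cart)
    qed simp
    show "?Q ?h"
    proof
      fix S :: "(real^'n) set" assume "S \<in> lmeasurable"
      from measure_linear_sufficient[OF lin this im] show "?h ` S \<in> lmeasurable \<and>
          measure lebesgue (?h ` S) = \<bar>det (matrix ?h)\<bar> * measure lebesgue S"
        using det by simp
    qed
  next
    fix m n :: 'n assume mn: "m \<noteq> n"
    let ?h = "\<lambda>x :: real^'n. \<chi> i. if i = m then x $ m + x $ n else x $ i"
    have lin: "linear ?h" by (rule linearI) (auto simp: vec_eq_iff algebra_simps)
    have "matrix ?h = (\<chi> k. if k = m then row m (mat 1) + 1 *s row n (mat 1) else row k (mat 1))"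
      by (auto simp: matrix_def vec_eq_iff mat_def axis_def row_def)
    then have det: "det (matrix ?h) = 1" using det_row_operation[OF mn, of "mat 1 :: real^'n^'n" 1] by simp
    have im: "measure lebesgue (?h ` cbox a b) = 1 * measure lebesgue (cbox a b)" for a b
    proof (cases "cbox a b = {}")
      case False
      \<comment> \<open>The shear formula for boxes wants a nonnegative lower bound in coordinate
        \<open>n\<close>; the translation by \<open>v\<close> moves this bound to 0.\<close>
      define v :: "real^'n" where "v = (\<chi> i. if i = n then - a $ n else 0)"
      have box: "(+) v ` cbox a b = cbox (v + a) (v + b)" by (rule cbox_translation[symmetric])
      have "?h ` cbox (v + a) (v + b) = (+) (?h v) ` ?h ` cbox a b"
        unfolding box[symmetric] image_image linear_add[OF lin] ..
      then have "measure lebesgue (?h ` cbox a b) = measure lebesgue (?h ` cbox (v + a) (v + b))"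
        by (simp add: measure_translation)
      also have "\<dots> = measure lebesgue (cbox (v + a) (v + b))"
        using False mn box by (intro measure_shear_interval) (auto simp: v_def)
      also have "\<dots> = measure lebesgue (cbox a b)" by (simp only: box[symmetric] measure_translation)
      finally show ?thesis by simp
    qed simp
    show "?Q ?h"
    proof
      fix S :: "(real^'n) set" assume "S \<in> lmeasurable"
      from measure_linear_sufficient[OF lin this im] show "?h ` S \<in> lmeasurable \<and>
          measure lebesgue (?h ` S) = \<bar>det (matrix ?h)\<bar> * measure lebesgue S"
        using det by simp
    qed
  qed
  then show ?thesis using assms(2) by blast
qed

text \<open>The direction \<open>n\<close> raises the affine dimension by at most one, so the prism
  still lies in a hyperplane.\<close>

lemma negligible_prism_lowdim:
  fixes S :: "'a::euclidean_space set"
  assumes "aff_dim S < int DIM('a) - 1"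
  shows "negligible (prism S n)"
proof (cases "S = {}")
  case False
  then obtain s where s: "s \<in> S" by blast
  let ?A = "affine hull (insert (s + n) S)"
  have "prism S n \<subseteq> ?A"
  proof
    fix z assume "z \<in> prism S n"
    then obtain y t where z: "z = y + t *\<^sub>R n" "y \<in> S" by (auto simp: prism_def)
    have "y + t *\<^sub>R ((s + n) - s) \<in> ?A"
      by (intro mem_affine_3_minus affine_affine_hull hull_inc) (use s z in auto)
    then show "z \<in> ?A" using z by simp
  qed
  moreover have "aff_dim ?A < int DIM('a)" using assms by (simp add: aff_dim_insert)
  then obtain a b where "a \<noteq> 0" "?A \<subseteq> {x. a \<bullet> x = b}"
    using aff_lowdim_subset_hyperplane by metis
  ultimately show ?thesis
    using negligible_hyperplane[of a b] negligible_subset by blast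
qed (simp add: prism_def)

section \<open>The prism over a simplex as an affine image\<close>

lemma mem_convex_hull_range:
  fixes v :: "'n::finite \<Rightarrow> 'a::real_vector"
  assumes "inj v"
  shows "y \<in> convex hull (range v) \<longleftrightarrow>
    (\<exists>u. (\<forall>i. 0 \<le> u i) \<and> (\<Sum>i\<in>UNIV. u i) = 1 \<and> y = (\<Sum>i\<in>UNIV. u i *\<^sub>R v i))"
proof
  assume "y \<in> convex hull (range v)"
  then obtain u where "\<forall>x\<in>range v. 0 \<le> u x" "sum u (range v) = 1" "y = (\<Sum>x\<in>range v. u x *\<^sub>R x)"
    by (auto simp: convex_hull_finite)
  then show "\<exists>u. (\<forall>i. 0 \<le> u i) \<and> (\<Sum>i\<in>UNIV. u i) = 1 \<and> y = (\<Sum>i\<in>UNIV. u i *\<^sub>R v i)"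
    using assms by (intro exI[of _ "u \<circ> v"]) (auto simp: sum.reindex)
next
  assume "\<exists>u. (\<forall>i. 0 \<le> u i) \<and> (\<Sum>i\<in>UNIV. u i) = 1 \<and> y = (\<Sum>i\<in>UNIV. u i *\<^sub>R v i)"
  then obtain u where u: "\<forall>i. 0 \<le> u i" "(\<Sum>i\<in>UNIV. u i) = 1" "y = (\<Sum>i\<in>UNIV. u i *\<^sub>R v i)" by blast
  show "y \<in> convex hull (range v)"
    unfolding u(3) by (rule convex_sum[OF _ convex_convex_hull]) (use u in \<open>auto intro: hull_inc\<close>)
qed

text \<open>The unit simplex in the coordinates other than \<open>k\<close>, times the unit interval
  in coordinate \<open>k\<close>. Its volume is carried along as a constant.\<close>

definition standard_prism :: "'n \<Rightarrow> (real^'n::finite) set" where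
  "standard_prism k = {z. (\<forall>i. 0 \<le> z $ i) \<and> (\<Sum>i\<in>UNIV - {k}. z $ i) \<le> 1 \<and> z $ k \<le> 1}"

lemma lmeasurable_standard_prism: "standard_prism (k :: 'n::finite) \<in> lmeasurable"
proof (rule measurable_convex)
  show "convex (standard_prism k)"
  proof (rule convexI)
    fix x y :: "real^'n" and u v :: real
    assume "x \<in> standard_prism k" "y \<in> standard_prism k" and uv: "0 \<le> u" "0 \<le> v" "u + v = 1"
    then have a: "\<forall>i. 0 \<le> x $ i" "(\<Sum>i\<in>UNIV - {k}. x $ i) \<le> 1" "x $ k \<le> 1"
      "\<forall>i. 0 \<le> y $ i" "(\<Sum>i\<in>UNIV - {k}. y $ i) \<le> 1" "y $ k \<le> 1"
      by (auto simp: standard_prism_def)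
    have "(\<Sum>i\<in>UNIV - {k}. u * x $ i + v * y $ i) \<le> 1"
      using convex_bound_le[OF a(2) a(5) uv] by (simp add: sum.distrib sum_distrib_left)
    moreover have "u * x $ k + v * y $ k \<le> 1" using convex_bound_le[OF a(3) a(6) uv] by simp
    ultimately show "u *\<^sub>R x + v *\<^sub>R y \<in> standard_prism k"
      using a uv by (simp add: standard_prism_def)
  qed
  have "standard_prism k \<subseteq> cbox 0 (\<chi> i. 1)"
  proof
    fix z :: "real^'n" assume z: "z \<in> standard_prism k"
    have "z $ i \<le> 1" for i
    proof (cases "i = k")
      case False
      then have "z $ i \<le> (\<Sum>i\<in>UNIV - {k}. z $ i)"
        using z by (intro member_le_sum) (auto simp: standard_prism_def)
      then show ?thesis using z by (simp add: standard_prism_def)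
    qed (use z in \<open>simp add: standard_prism_def\<close>)
    then show "z \<in> cbox 0 (\<chi> i. 1)" using z by (auto simp: mem_box_cart standard_prism_def)
  qed
  then show "bounded (standard_prism k)" using bounded_cbox bounded_subset by blast
qed

text \<open>With \<open>v k\<close> as origin, barycentric coordinates and the height along
  \<open>n\<close> present the prism as a translated linear image of
  \<open>standard_prism k\<close>; the determinant is that of the image vectors \<open>n\<close> and
  \<open>v i - v k\<close>.\<close>

lemma measure_prism_simplex:
  fixes v :: "'n::finite \<Rightarrow> real^'n" and n :: "real^'n"
  assumes inj: "inj v"
  shows "measure lebesgue (prism (convex hull (range v)) n) =
    \<bar>det (\<chi> i. if i = k then n else v i - v k)\<bar> * measure lebesgue (standard_prism k)"
proof -
  define r where "r = (\<lambda>i. if i = k then n else v i - v k)"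
  define f where "f = (\<lambda>z :: real^'n. \<Sum>i\<in>UNIV. z $ i *\<^sub>R r i)"
  have lin: "linear f"
    by (rule linearI) (auto simp: f_def scaleR_add_left sum.distrib scaleR_sum_right)
  have "f (axis i 1) = r i" for i
  proof -
    have "f (axis i 1) = (\<Sum>j\<in>UNIV. if j = i then r j else 0)"
      unfolding f_def by (intro sum.cong) (auto simp: axis_def)
    then show ?thesis by simp
  qed
  then have "matrix f = transpose (\<chi> i. r i)" by (simp add: matrix_def transpose_def vec_eq_iff)
  then have det: "det (matrix f) = det (\<chi> i. r i)" by simp
  have split: "(\<Sum>i\<in>UNIV. g i) = g k + (\<Sum>i\<in>UNIV - {k}. g i)" for g :: "'n \<Rightarrow> 'b::comm_monoid_add"
    by (rule sum.remove) auto
  have fz: "v k + f z = (\<Sum>i\<in>UNIV - {k}. z $ i *\<^sub>R v i) + (1 - (\<Sum>i\<in>UNIV - {k}. z $ i)) *\<^sub>R v k + z $ k *\<^sub>R n" for z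
  proof -
    have "f z = z $ k *\<^sub>R n + (\<Sum>i\<in>UNIV - {k}. z $ i *\<^sub>R (v i - v k))"
      unfolding f_def by (subst split) (auto simp: r_def intro!: sum.cong)
    also have "(\<Sum>i\<in>UNIV - {k}. z $ i *\<^sub>R (v i - v k)) =
        (\<Sum>i\<in>UNIV - {k}. z $ i *\<^sub>R v i) - (\<Sum>i\<in>UNIV - {k}. z $ i) *\<^sub>R v k"
      by (simp add: scaleR_diff_right sum_subtractf scaleR_sum_left)
    finally show ?thesis by (simp add: algebra_simps)
  qed
  have "prism (convex hull (range v)) n = (+) (v k) ` f ` standard_prism k"
  proof (intro equalityI subsetI)
    fix p assume "p \<in> prism (convex hull (range v)) n"
    then obtain u t where u: "\<forall>i. 0 \<le> u i" "(\<Sum>i\<in>UNIV. u i) = 1" "0 \<le> t" "t \<le> 1"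
      "p = (\<Sum>i\<in>UNIV. u i *\<^sub>R v i) + t *\<^sub>R n"
      by (auto simp: prism_def mem_convex_hull_range[OF inj])
    \<comment> \<open>The weight of \<open>v k\<close> is determined by the other weights, so
      coordinate \<open>k\<close> is free to hold the height \<open>t\<close>.\<close>
    define z where "z = (\<chi> i. if i = k then t else u i)"
    have s: "(\<Sum>i\<in>UNIV - {k}. z $ i) = 1 - u k"
      using u(2) split[of u] by (simp add: z_def cong: sum.cong_simp)
    have s': "(\<Sum>i\<in>UNIV - {k}. z $ i *\<^sub>R v i) = (\<Sum>i\<in>UNIV - {k}. u i *\<^sub>R v i)"
      by (intro sum.cong) (auto simp: z_def)
    have "v k + f z = p"
      unfolding fz s s' u(5) by (subst split[of "\<lambda>i. u i *\<^sub>R v i"]) (simp add: z_def algebra_simps)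
    moreover have "z \<in> standard_prism k" using u s by (auto simp: standard_prism_def) (auto simp: z_def)
    ultimately show "p \<in> (+) (v k) ` f ` standard_prism k" by blast
  next
    fix p assume "p \<in> (+) (v k) ` f ` standard_prism k"
    then obtain z where z: "z \<in> standard_prism k" "p = v k + f z" by blast
    define u where "u = (\<lambda>i. if i = k then 1 - (\<Sum>i\<in>UNIV - {k}. z $ i) else z $ i)"
    have s: "(\<Sum>i\<in>UNIV - {k}. u i) = (\<Sum>i\<in>UNIV - {k}. z $ i)"
      "(\<Sum>i\<in>UNIV - {k}. u i *\<^sub>R v i) = (\<Sum>i\<in>UNIV - {k}. z $ i *\<^sub>R v i)"
      by (auto simp: u_def intro!: sum.cong)
    have "(\<Sum>i\<in>UNIV. u i) = 1" by (subst split) (simp only: s, simp add: u_def)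
    moreover have "\<forall>i. 0 \<le> u i" using z(1) by (auto simp: u_def standard_prism_def)
    moreover have "p = (\<Sum>i\<in>UNIV. u i *\<^sub>R v i) + z $ k *\<^sub>R n"
      unfolding z(2) fz by (subst split[of "\<lambda>i. u i *\<^sub>R v i"]) (simp only: s, simp add: u_def algebra_simps)
    moreover have "0 \<le> z $ k" "z $ k \<le> 1" using z(1) by (auto simp: standard_prism_def)
    moreover from calculation have "(\<Sum>i\<in>UNIV. u i *\<^sub>R v i) \<in> convex hull (range v)"
      unfolding mem_convex_hull_range[OF inj] by blast
    ultimately show "p \<in> prism (convex hull (range v)) n" by (auto simp: prism_def)
  qed
  then have "measure lebesgue (prism (convex hull (range v)) n) = measure lebesgue (f ` standard_prism k)"
    by (simp add: measure_translation)
  also have "\<dots> = \<bar>det (\<chi> i. r i)\<bar> * measure lebesgue (standard_prism k)"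
    using measure_linear_image_det[OF lin lmeasurable_standard_prism] det by simp
  finally show ?thesis by (simp add: r_def)
qed

text \<open>Only the component of \<open>u\<close> along \<open>n\<close> counts: with the remaining
  component as row \<open>k\<close>, all rows are orthogonal to \<open>n\<close> and the matrix is
  singular.\<close>

lemma det_replace_row_orthogonal:
  fixes r :: "'n::finite \<Rightarrow> real^'n" and n u :: "real^'n"
  assumes n: "norm n = 1" and r: "\<And>i. i \<noteq> k \<Longrightarrow> r i \<bullet> n = 0"
  shows "det (\<chi> i. if i = k then u else r i) = (u \<bullet> n) * det (\<chi> i. if i = k then n else r i)"
proof -
  define w where "w = u - (u \<bullet> n) *\<^sub>R n"
  have nn: "n \<bullet> n = 1" using n by (simp add: norm_eq_1)
  have "(\<chi> i. if i = k then w else r i) *v n = 0"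
    by (auto simp: vec_eq_iff matrix_vector_mul_component w_def inner_diff_left nn r)
  moreover have "n \<noteq> 0" using n by auto
  ultimately have "det (\<chi> i. if i = k then w else r i) = 0"
    using invertible_det_nz[of "\<chi> i. if i = k then w else r i"]
    by (metis invertible_def matrix_left_invertible_ker)
  moreover have "u = (u \<bullet> n) *s n + w" by (simp add: w_def scalar_mult_eq_scaleR)
  then have "det (\<chi> i. if i = k then u else r i) =
      det (\<chi> i. if i = k then (u \<bullet> n) *s n else r i) + det (\<chi> i. if i = k then w else r i)"
    using det_row_add[of k "\<lambda>i. (u \<bullet> n) *s n" "\<lambda>i. w" r] by metis
  ultimately show ?thesis using det_row_mul[of k "u \<bullet> n" "\<lambda>i. n" r] by simp
qed

lemma det_add_multiples_of_row:
  fixes A :: "real^'n^'n" and s :: "'n::finite \<Rightarrow> real"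
  shows "det (\<chi> i. if i = k then A $ k else A $ i + s i *s A $ k) = det A"
proof -
  have "det (\<chi> i. if i \<in> S then A $ i + s i *s A $ k else A $ i) = det A"
    if "finite S" "k \<notin> S" for S
    using that
  proof (induction S)
    case (insert j S)
    let ?B = "\<chi> i. if i \<in> S then A $ i + s i *s A $ k else A $ i"
    have jk: "j \<noteq> k" using insert by auto
    have "(\<chi> i. if i \<in> insert j S then A $ i + s i *s A $ k else A $ i) =
        (\<chi> i. if i = j then row j ?B + s j *s row k ?B else row i ?B)"
      using insert by (auto simp: vec_eq_iff row_def)
    then show ?case using det_row_operation[OF jk, of ?B "s j"] insert by simp
  qed simp
  from this[of "UNIV - {k}"] show ?thesis
    by (simp add: if_distrib cong: if_cong) (smt (verit, best) Cart_lambda_cong)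
qed

text \<open>The direction \<open>u\<close> of an edge through the vertex \<open>w k\<close> replaces the unit normal, so that no
  power of the norm of \<open>x\<close> survives.\<close>

lemma measure_prism_section_simplex:
  fixes w :: "'n::finite \<Rightarrow> real^'n" and x u a :: "real^'n"
  assumes inj: "inj w" and x: "x \<noteq> 0" and w: "\<And>i. x \<bullet> w i = 0"
    and u: "x \<bullet> u \<noteq> 0" and wk: "w k = a + s *\<^sub>R u"
  shows "measure lebesgue (prism (convex hull (range w)) (sgn x)) / norm x =
    measure lebesgue (standard_prism k) * \<bar>det (\<chi> i. if i = k then u else w i - a) / (x \<bullet> u)\<bar>"
proof -
  have n: "norm (sgn x) = 1" using x by (simp add: norm_sgn)
  have un: "u \<bullet> sgn x = (x \<bullet> u) / norm x" by (simp add: sgn_div_norm inner_commute divide_inverse mult.commute)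
  have "(w i - w k) \<bullet> sgn x = 0" for i
    using w by (simp add: sgn_div_norm inner_diff_right inner_commute[of _ x])
  then have "det (\<chi> i. if i = k then u else w i - w k) =
      (x \<bullet> u) / norm x * det (\<chi> i. if i = k then sgn x else w i - w k)"
    using det_replace_row_orthogonal[OF n, of k "\<lambda>i. w i - w k" u] un by simp
  \<comment> \<open>Since \<open>w k - a\<close> is \<open>s\<close> times the row \<open>u\<close>,
    changing the base point from \<open>w k\<close> to \<open>a\<close> is a row operation. In the
    application \<open>w k\<close> moves with \<open>x\<close>, whereas \<open>a\<close> is a fixed
    end of an edge.\<close>
  moreover have "det (\<chi> i. if i = k then u else w i - a) = det (\<chi> i. if i = k then u else w i - w k)"
  proof -
    let ?A = "\<chi> i. if i = k then u else w i - w k"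
    have "(\<chi> i. if i = k then ?A $ k else ?A $ i + s *s ?A $ k) = (\<chi> i. if i = k then u else w i - a)"
      using wk by (auto simp: vec_eq_iff)
    then show ?thesis using det_add_multiples_of_row[of k ?A "\<lambda>_. s"] by simp
  qed
  ultimately have "det (\<chi> i. if i = k then sgn x else w i - w k) =
      norm x * (det (\<chi> i. if i = k then u else w i - a) / (x \<bullet> u))"
    using u x by (simp add: field_simps)
  then show ?thesis
    using x by (simp add: measure_prism_simplex[OF inj, of "sgn x" k] abs_mult)
qed

subsection \<open>Polynomial functions and irreducible sets\<close>

text \<open>A predicate on functions with only an upper bound on the degree, so that cancellation in
  sums does no harm.\<close>

definition poly_fun :: "nat \<Rightarrow> (real^'n::finite \<Rightarrow> real) \<Rightarrow> bool" where
  "poly_fun k f \<longleftrightarrow> (\<exists>c. is_mpoly c \<and> mpoly_deg c \<le> k \<and> (\<forall>x. mpoly_eval c x = f x))"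

lemma mpoly_deg_le_iff:
  assumes "is_mpoly c"
  shows "mpoly_deg c \<le> k \<longleftrightarrow> (\<forall>\<alpha>. c \<alpha> \<noteq> 0 \<longrightarrow> (\<Sum>i\<in>UNIV. \<alpha> i) \<le> k)"
proof -
  have "{(\<Sum>i\<in>UNIV. \<alpha> i) | \<alpha>. c \<alpha> \<noteq> 0} = (\<lambda>\<alpha>. \<Sum>i\<in>UNIV. \<alpha> i) ` {\<alpha>. c \<alpha> \<noteq> 0}" by auto
  then show ?thesis using assms by (auto simp: mpoly_deg_def is_mpoly_def)
qed

lemma mpoly_eval_superset:
  assumes "finite S" "{\<alpha>. c \<alpha> \<noteq> 0} \<subseteq> S"
  shows "mpoly_eval c x = (\<Sum>\<alpha>\<in>S. c \<alpha> * (\<Prod>i\<in>UNIV. (x $ i) ^ (\<alpha> i)))"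
  unfolding mpoly_eval_def by (rule sum.mono_neutral_left) (use assms in auto)

lemma mpoly_eval_zero: "mpoly_eval (\<lambda>_. 0) x = 0"
  by (simp add: mpoly_eval_def)

lemma poly_fun_monomial:
  assumes "(\<Sum>i\<in>UNIV. \<alpha> i) \<le> k"
  shows "poly_fun k (\<lambda>x. a * (\<Prod>i\<in>UNIV. (x $ i) ^ (\<alpha> i)))"
proof -
  define c where "c = (\<lambda>\<beta>. if \<beta> = \<alpha> then a else 0)"
  have fin: "finite {\<alpha>}" and sub: "{\<beta>. c \<beta> \<noteq> 0} \<subseteq> {\<alpha>}" by (auto simp: c_def)
  then have "is_mpoly c" unfolding is_mpoly_def by (rule finite_subset[rotated])
  moreover have "mpoly_eval c x = a * (\<Prod>i\<in>UNIV. (x $ i) ^ (\<alpha> i))" for x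
    using mpoly_eval_superset[OF fin sub, of x] by (simp add: c_def)
  moreover have "mpoly_deg c \<le> k"
    using assms by (subst mpoly_deg_le_iff[OF \<open>is_mpoly c\<close>]) (auto simp: c_def)
  ultimately show ?thesis unfolding poly_fun_def by blast
qed

lemma poly_fun_add:
  assumes "poly_fun k f" "poly_fun k g"
  shows "poly_fun k (\<lambda>x. f x + g x)"
proof -
  obtain c d where c: "is_mpoly c" "mpoly_deg c \<le> k" "\<And>x. mpoly_eval c x = f x"
    and d: "is_mpoly d" "mpoly_deg d \<le> k" "\<And>x. mpoly_eval d x = g x"
    using assms by (auto simp: poly_fun_def)
  define S where "S = {\<alpha>. c \<alpha> \<noteq> 0} \<union> {\<alpha>. d \<alpha> \<noteq> 0}"
  define e where "e = (\<lambda>\<alpha>. c \<alpha> + d \<alpha>)"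
  have S: "finite S" "{\<alpha>. c \<alpha> \<noteq> 0} \<subseteq> S" "{\<alpha>. d \<alpha> \<noteq> 0} \<subseteq> S" "{\<alpha>. e \<alpha> \<noteq> 0} \<subseteq> S"
    using c(1) d(1) by (auto simp: S_def is_mpoly_def e_def)
  then have e: "is_mpoly e" unfolding is_mpoly_def using finite_subset by blast
  moreover have "mpoly_eval e x = f x + g x" for x
    unfolding c(3)[symmetric] d(3)[symmetric] mpoly_eval_superset[OF S(1,2)]
      mpoly_eval_superset[OF S(1,3)] mpoly_eval_superset[OF S(1,4)]
    by (simp add: e_def sum.distrib distrib_right)
  moreover have "mpoly_deg e \<le> k"
    using c(2) d(2) S(4) unfolding mpoly_deg_le_iff[OF c(1)] mpoly_deg_le_iff[OF d(1)] mpoly_deg_le_iff[OF e]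
    by (auto simp: S_def)
  ultimately show ?thesis unfolding poly_fun_def by blast
qed

lemma poly_fun_mono: "poly_fun k f \<Longrightarrow> k \<le> l \<Longrightarrow> poly_fun l f"
  unfolding poly_fun_def using order_trans by blast

lemma poly_fun_const: "poly_fun k (\<lambda>x. a)"
  using poly_fun_monomial[of "\<lambda>_. 0" k a] by simp

lemma poly_fun_sum:
  assumes "\<And>i. i \<in> I \<Longrightarrow> poly_fun k (f i)"
  shows "poly_fun k (\<lambda>x. \<Sum>i\<in>I. f i x)"
  using assms
  by (induction I rule: infinite_finite_induct) (auto intro: poly_fun_const poly_fun_add)

text \<open>The product is expanded into a double sum of monomials, which avoids computing its
  coefficients.\<close>

lemma poly_fun_mult:
  assumes "poly_fun k f" "poly_fun l g"
  shows "poly_fun (k + l) (\<lambda>x. f x * g x)"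
proof -
  obtain c d where c: "is_mpoly c" "mpoly_deg c \<le> k" "\<And>x. mpoly_eval c x = f x"
    and d: "is_mpoly d" "mpoly_deg d \<le> l" "\<And>x. mpoly_eval d x = g x"
    using assms by (auto simp: poly_fun_def)
  have "poly_fun (k + l) (\<lambda>x. \<Sum>\<alpha> | c \<alpha> \<noteq> 0. \<Sum>\<beta> | d \<beta> \<noteq> 0.
    (c \<alpha> * d \<beta>) * (\<Prod>i\<in>UNIV. (x $ i) ^ (\<alpha> i + \<beta> i)))"
  proof (intro poly_fun_sum poly_fun_monomial)
    fix \<alpha> \<beta> assume "\<alpha> \<in> {\<alpha>. c \<alpha> \<noteq> 0}" "\<beta> \<in> {\<beta>. d \<beta> \<noteq> 0}"
    then have "(\<Sum>i\<in>UNIV. \<alpha> i) \<le> k" "(\<Sum>i\<in>UNIV. \<beta> i) \<le> l"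
      using c(2) d(2) unfolding mpoly_deg_le_iff[OF c(1)] mpoly_deg_le_iff[OF d(1)] by auto
    then show "(\<Sum>i\<in>UNIV. \<alpha> i + \<beta> i) \<le> k + l" by (simp add: sum.distrib)
  qed
  moreover have "(\<Sum>\<alpha> | c \<alpha> \<noteq> 0. \<Sum>\<beta> | d \<beta> \<noteq> 0.
    (c \<alpha> * d \<beta>) * (\<Prod>i\<in>UNIV. (x $ i) ^ (\<alpha> i + \<beta> i))) = f x * g x" for x
    unfolding c(3)[symmetric] d(3)[symmetric] mpoly_eval_def sum_product
    by (simp add: power_add prod.distrib algebra_simps)
  ultimately show ?thesis by simp
qed

lemma poly_fun_cmult: "poly_fun k f \<Longrightarrow> poly_fun k (\<lambda>x. a * f x)"
  using poly_fun_mult[OF poly_fun_const[of 0 a], of k f] by simp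

lemma poly_fun_diff: "poly_fun k f \<Longrightarrow> poly_fun k g \<Longrightarrow> poly_fun k (\<lambda>x. f x - g x)"
  using poly_fun_add[of k f "\<lambda>x. (-1) * g x"] poly_fun_cmult[of k g "-1"] by simp

lemma poly_fun_prod:
  assumes "finite I" "\<And>i. i \<in> I \<Longrightarrow> poly_fun (k i) (f i)"
  shows "poly_fun (\<Sum>i\<in>I. k i) (\<lambda>x. \<Prod>i\<in>I. f i x)"
  using assms by (induction I) (auto intro: poly_fun_const poly_fun_mult)

lemma poly_fun_component:
  fixes j :: "'n::finite"
  shows "poly_fun 1 (\<lambda>x. x $ j)"
proof -
  have "(\<Prod>i\<in>UNIV. (x $ i) ^ (if i = j then 1 else 0)) = x $ j" for x :: "real^'n"
    by (simp add: if_distrib cong: if_cong)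
  then show ?thesis using poly_fun_monomial[of "\<lambda>i. if i = j then 1 else 0" 1 1] by simp
qed

lemma poly_fun_inner: "poly_fun 1 (\<lambda>x. x \<bullet> a)"
  unfolding inner_vec_def inner_real_def
  by (intro poly_fun_sum) (metis (no_types, lifting) ext mult.commute poly_fun_cmult poly_fun_component)

text \<open>Each term of the Leibniz formula takes one entry from every row, so degree bounds for
  the rows add up.\<close>

lemma poly_fun_det:
  fixes A :: "real^'m \<Rightarrow> real^'n^'n"
  assumes "\<And>i j. poly_fun (k i) (\<lambda>x. A x $ i $ j)"
  shows "poly_fun (\<Sum>i\<in>UNIV. k i) (\<lambda>x. det (A x))"
  unfolding det_def by (intro poly_fun_sum poly_fun_cmult poly_fun_prod assms) auto

section \<open>Irreducible sets covered by zero sets of polynomials\<close>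

lemma zariski_closed_Int_zeros:
  assumes "zariski_closed V" "is_mpoly c"
  shows "zariski_closed (V \<inter> {x. mpoly_eval c x = 0})"
proof -
  obtain F where "\<forall>c\<in>F. is_mpoly c" "V = {x. \<forall>c\<in>F. mpoly_eval c x = 0}"
    using assms(1) by (auto simp: zariski_closed_def)
  then show ?thesis
    unfolding zariski_closed_def using assms(2) by (intro exI[of _ "insert c F"]) auto
qed

text \<open>Induction on \<open>F\<close>: the zeros of \<open>f\<close> and the zeros of the
  product of the other functions cut \<open>C\<close> into two closed pieces, one of which is all of
  \<open>C\<close>. An empty \<open>F\<close> is excluded because \<open>C\<close> is
  nonempty.\<close>

lemma zariski_irreducible_subset_zeros:
  assumes C: "zariski_irreducible C" and "finite F" "\<And>f. f \<in> F \<Longrightarrow> poly_fun k f"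
    and "\<And>x. x \<in> C \<Longrightarrow> \<exists>f\<in>F. f x = 0"
  shows "\<exists>f\<in>F. \<forall>x\<in>C. f x = 0"
proof -
  have "C \<subseteq> {x. \<exists>f\<in>F. f x = 0}" using assms(4) by blast
  with assms(2,3) show ?thesis
  proof (induction F)
    case empty
    then show ?case using C by (simp add: zariski_irreducible_def)
  next
    case (insert f F)
    obtain c where c: "is_mpoly c" "\<And>x. mpoly_eval c x = f x"
      using insert.prems(1)[of f] by (auto simp: poly_fun_def)
    have "poly_fun (\<Sum>g\<in>F. k) (\<lambda>x. \<Prod>g\<in>F. g x)"
      using insert by (intro poly_fun_prod) auto
    then obtain d where d: "is_mpoly d" "\<And>x. mpoly_eval d x = (\<Prod>g\<in>F. g x)"
      by (auto simp: poly_fun_def)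
    have "C = (C \<inter> {x. mpoly_eval c x = 0}) \<union> (C \<inter> {x. mpoly_eval d x = 0})"
      using insert.prems(2) insert.hyps(1) by (auto simp: c d)
    moreover have "zariski_closed C" using C by (simp add: zariski_irreducible_def)
    ultimately have "C = C \<inter> {x. mpoly_eval c x = 0} \<or> C = C \<inter> {x. mpoly_eval d x = 0}"
      using C zariski_closed_Int_zeros c(1) d(1) unfolding zariski_irreducible_def by blast
    then show ?case
    proof
      assume "C = C \<inter> {x. mpoly_eval c x = 0}"
      then show ?case using c by auto
    next
      assume "C = C \<inter> {x. mpoly_eval d x = 0}"
      then have "C \<subseteq> {x. mpoly_eval d x = 0}" by blast
      then have "C \<subseteq> {x. \<exists>g\<in>F. g x = 0}" using insert.hyps(1) by (auto simp: d)
      then show ?case using insert by auto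
    qed
  qed
qed

text \<open>The product over \<open>F\<close> vanishes on \<open>S\<close>, hence on its closure and
  on \<open>C\<close>. By irreducibility one member of \<open>F\<close> vanishes on all of
  \<open>C\<close>, and it competes in the minimum that defines the degree.\<close>

lemma hypersurface_degree_le:
  assumes C: "zariski_irreducible C" "C \<subseteq> zariski_closure S"
    and F: "finite F" "\<And>f. f \<in> F \<Longrightarrow> poly_fun k f" "\<And>f. f \<in> F \<Longrightarrow> \<exists>x. f x \<noteq> 0"
    and S: "\<And>x. x \<in> S \<Longrightarrow> \<exists>f\<in>F. f x = 0"
  shows "hypersurface_degree C \<le> k"
proof -
  have "poly_fun (\<Sum>f\<in>F. k) (\<lambda>x. \<Prod>f\<in>F. f x)"
    using F by (intro poly_fun_prod) auto
  then obtain d where d: "is_mpoly d" "\<And>x. mpoly_eval d x = (\<Prod>f\<in>F. f x)"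
    by (auto simp: poly_fun_def)
  have "\<forall>y\<in>S. mpoly_eval d y = 0" using S F(1) by (auto simp: d)
  then have "\<exists>f\<in>F. f x = 0" if "x \<in> C" for x
    using C(2) that d F(1) by (force simp: zariski_closure_def)
  then obtain f where f: "f \<in> F" "\<forall>x\<in>C. f x = 0"
    using zariski_irreducible_subset_zeros[OF C(1) F(1,2)] by blast
  obtain c where c: "is_mpoly c" "mpoly_deg c \<le> k" "\<And>x. mpoly_eval c x = f x"
    using F(2)[OF f(1)] by (auto simp: poly_fun_def)
  obtain x where "f x \<noteq> 0" using F(3)[OF f(1)] by blast
  then have "c \<noteq> (\<lambda>_. 0)" using c(3)[of x] mpoly_eval_zero by metis
  then have "hypersurface_degree C \<le> mpoly_deg c"
    unfolding hypersurface_degree_def using c f(2) by (intro Least_le) auto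
  then show ?thesis using c(2) by simp
qed

subsection \<open>The boundary of the intersection body\<close>

text \<open>An orientation chosen once for each edge. It depends on the edge alone and not on
  \<open>x\<close>, so ends and directions are constants in the polynomials below.\<close>

definition edge_ends :: "'a::euclidean_space set \<Rightarrow> 'a \<times> 'a" where
  "edge_ends E = (SOME pq. E = closed_segment (fst pq) (snd pq))"

abbreviation edge_start where "edge_start E \<equiv> fst (edge_ends E)"

definition edge_dir :: "'a::euclidean_space set \<Rightarrow> 'a" where
  "edge_dir E = snd (edge_ends E) - fst (edge_ends E)"

text \<open>The vertices of a generic central section: \<open>Some E\<close> stands for the intersection of the
  hyperplane with the edge \<open>E\<close>, and \<open>None\<close> for the origin, which may itself be a vertex of the
  polytope.\<close>

definition section_point :: "'a::euclidean_space set option \<Rightarrow> 'a \<Rightarrow> 'a" where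
  "section_point \<sigma> x = (case \<sigma> of None \<Rightarrow> 0
    | Some E \<Rightarrow> edge_start E - ((x \<bullet> edge_start E) / (x \<bullet> edge_dir E)) *\<^sub>R edge_dir E)"

text \<open>Up to sign and a constant, what one simplex of the section contributes to the radial
  function. \<open>\<tau>\<close> labels its vertices, and \<open>k\<close> selects one on an edge,
  whose direction fills row \<open>k\<close>.\<close>

definition simplex_term :: "('n::finite \<Rightarrow> (real^'n) set option) \<times> 'n \<Rightarrow> real^'n \<Rightarrow> real" where
  "simplex_term \<omega> x = (case \<omega> of (\<tau>, k) \<Rightarrow>
     det (\<chi> i. if i = k then edge_dir (the (\<tau> k)) else section_point (\<tau> i) x - edge_start (the (\<tau> k)))
       / (x \<bullet> edge_dir (the (\<tau> k))))"

text \<open>Injectivity of \<open>\<tau>\<close> ensures that each linear form occurs at most once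
  as a denominator. The set depends on \<open>x\<close> only through the crossing edges
  \<open>X\<close>.\<close>

definition simplex_indices :: "(real^'n::finite) set set \<Rightarrow> (('n \<Rightarrow> (real^'n) set option) \<times> 'n) set" where
  "simplex_indices X = {(\<tau>, k). inj \<tau> \<and> range \<tau> \<subseteq> insert None (Some ` X) \<and> \<tau> k \<noteq> None}"

lemma finite_simplex_indices:
  fixes X :: "(real^'n::finite) set set"
  assumes "finite X"
  shows "finite (simplex_indices X)"
proof -
  have "finite (PiE (UNIV :: 'n set) (\<lambda>_. insert None (Some ` X)))"
    using assms by (intro finite_PiE) auto
  moreover have "simplex_indices X \<subseteq> PiE UNIV (\<lambda>_. insert None (Some ` X)) \<times> UNIV"
    by (auto simp: simplex_indices_def)
  ultimately show ?thesis by (rule finite_subset[rotated, OF finite_cartesian_product[OF _ finite_class.finite_UNIV]])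
qed

lemma section_point_scaleR: "c \<noteq> 0 \<Longrightarrow> section_point \<sigma> (c *\<^sub>R x) = section_point \<sigma> x"
  by (auto simp: section_point_def split: option.splits)

lemma simplex_term_scaleR: "c \<noteq> 0 \<Longrightarrow> simplex_term \<omega> (c *\<^sub>R x) = simplex_term \<omega> x / c"
  by (simp add: simplex_term_def section_point_scaleR mult.commute split: prod.splits cong: if_cong)

text \<open>Multiplying a row labelled by an edge with the form of this edge makes it linear in
  \<open>x\<close>; rows labelled \<open>None\<close> are constant already. The labels are distinct,
  so only forms from \<open>Y\<close> are consumed, each once, and those of \<open>X - Y\<close>
  remain as factors.\<close>

lemma simplex_term_clear_denominators:
  fixes X :: "(real^'n::finite) set set"
  assumes X: "finite X" and \<omega>: "\<omega> \<in> simplex_indices X"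
  shows "\<exists>G. poly_fun (card X) G \<and>
    (\<forall>x. (\<forall>E\<in>X. x \<bullet> edge_dir E \<noteq> 0) \<longrightarrow> G x = (\<Prod>E\<in>X. x \<bullet> edge_dir E) * simplex_term \<omega> x)"
proof -
  obtain \<tau> k where \<tau>k: "\<omega> = (\<tau>, k)" "inj \<tau>" "range \<tau> \<subseteq> insert None (Some ` X)" "\<tau> k \<noteq> None"
    using \<omega> by (auto simp: simplex_indices_def)
  then obtain E0 where E0: "\<tau> k = Some E0" by auto
  define Y where "Y = {E. Some E \<in> range \<tau>}"
  have YX: "Y \<subseteq> X" using \<tau>k(3) by (auto simp: Y_def)
  have finY: "finite Y" using X YX finite_subset by blast
  have im: "\<tau> ` {i. \<tau> i \<noteq> None} = Some ` Y"
  proof (intro equalityI subsetI)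
    fix b assume "b \<in> Some ` Y"
    then obtain E where "b = Some E" "Some E \<in> range \<tau>" by (auto simp: Y_def)
    then obtain i where "b = Some E" "\<tau> i = Some E" by (metis imageE)
    then show "b \<in> \<tau> ` {i. \<tau> i \<noteq> None}" by (intro image_eqI[of _ _ i]) auto
  next
    fix b assume "b \<in> \<tau> ` {i. \<tau> i \<noteq> None}"
    then obtain E i where "b = Some E" "\<tau> i = Some E" by auto
    then show "b \<in> Some ` Y" unfolding Y_def by (metis (mono_tags) imageI mem_Collect_eq rangeI)
  qed
  have inj': "inj_on \<tau> {i. \<tau> i \<noteq> None}" using \<tau>k(2) inj_on_subset by blast
  \<comment> \<open>\<open>l\<close> is the denominator of a section point and \<open>N\<close> the
    numerator of its difference to \<open>edge_start E0\<close>.\<close>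
  define l where "l = (\<lambda>\<sigma> (x :: real^'n). case \<sigma> of None \<Rightarrow> 1 | Some E \<Rightarrow> x \<bullet> edge_dir E)"
  define N where "N = (\<lambda>\<sigma> (x :: real^'n). case \<sigma> of None \<Rightarrow> - edge_start E0
    | Some E \<Rightarrow> (x \<bullet> edge_dir E) *\<^sub>R (edge_start E - edge_start E0) - (x \<bullet> edge_start E) *\<^sub>R edge_dir E)"
  define A where "A = (\<lambda>x. \<chi> i. if i = k then edge_dir E0 else N (\<tau> i) x)"
  define M where "M = (\<lambda>x. \<chi> i. if i = k then edge_dir E0 else section_point (\<tau> i) x - edge_start E0)"
  define G where "G = (\<lambda>x. det (A x) * (\<Prod>E\<in>X - Y. x \<bullet> edge_dir E))"
  \<comment> \<open>Row \<open>k\<close> is constant but counted with degree 1, which makes the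
    total exactly \<open>card Y\<close>.\<close>
  have "poly_fun (\<Sum>i\<in>UNIV. if \<tau> i = None then 0 else 1) (\<lambda>x. det (A x))"
  proof (rule poly_fun_det)
    fix i j
    show "poly_fun (if \<tau> i = None then 0 else 1) (\<lambda>x. A x $ i $ j)"
    proof (cases "i = k \<or> \<tau> i = None")
      case True
      then show ?thesis by (cases "i = k") (simp_all add: A_def N_def poly_fun_const)
    next
      case False
      then obtain E where E: "\<tau> i = Some E" "i \<noteq> k" by auto
      have "poly_fun 1 (\<lambda>x. (edge_start E - edge_start E0) $ j * (x \<bullet> edge_dir E)
          - edge_dir E $ j * (x \<bullet> edge_start E))"
        by (intro poly_fun_diff poly_fun_cmult poly_fun_inner)
      moreover have "A x $ i $ j = (edge_start E - edge_start E0) $ j * (x \<bullet> edge_dir E)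
          - edge_dir E $ j * (x \<bullet> edge_start E)" for x
        using E by (simp add: A_def N_def mult.commute)
      ultimately show ?thesis using E by simp
    qed
  qed
  moreover have "(\<Sum>i\<in>UNIV. if \<tau> i = None then 0 else (1::nat)) = card Y"
  proof -
    have "(\<Sum>i\<in>UNIV. if \<tau> i = None then 0 else (1::nat)) = (\<Sum>i | \<tau> i \<noteq> None. 1)"
      by (rule sum.mono_neutral_cong_right) auto
    also have "\<dots> = card (\<tau> ` {i. \<tau> i \<noteq> None})" using card_image[OF inj'] by simp
    also have "\<dots> = card Y" unfolding im by (rule card_image) simp
    finally show ?thesis .
  qed
  moreover have "poly_fun (\<Sum>E\<in>X - Y. 1) (\<lambda>x. \<Prod>E\<in>X - Y. x \<bullet> edge_dir E)"
    using X by (intro poly_fun_prod poly_fun_inner) auto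
  ultimately have "poly_fun (card Y + card (X - Y)) G"
    unfolding G_def by (intro poly_fun_mult) simp_all
  moreover have "card Y + card (X - Y) = card X"
    using X YX finY by (simp add: card_Diff_subset card_mono)
  ultimately have "poly_fun (card X) G" by simp
  moreover have "G x = (\<Prod>E\<in>X. x \<bullet> edge_dir E) * simplex_term \<omega> x"
    if nz: "\<forall>E\<in>X. x \<bullet> edge_dir E \<noteq> 0" for x
  proof -
    have nzi: "x \<bullet> edge_dir E \<noteq> 0" if "\<tau> i = Some E" for i E
      using nz YX that by (metis (mono_tags, lifting) Y_def mem_Collect_eq rangeI subsetD)
    have "N (\<tau> i) x = l (\<tau> i) x *s (section_point (\<tau> i) x - edge_start E0)" for i
    proof (cases "\<tau> i")
      case (Some E)
      then show ?thesis using nzi[OF Some]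
        by (simp add: N_def l_def section_point_def scalar_mult_eq_scaleR scaleR_diff_right)
    qed (simp add: N_def l_def section_point_def scalar_mult_eq_scaleR)
    then have "A x = (\<chi> i. (if i = k then 1 else l (\<tau> i) x) *s (M x $ i))"
      by (auto simp: A_def M_def vec_eq_iff right_diff_distrib)
    then have dA: "det (A x) = (\<Prod>i\<in>UNIV. if i = k then 1 else l (\<tau> i) x) * det (M x)"
      by (simp add: det_rows_mul)
    \<comment> \<open>Besides the forms absorbed by \<open>A\<close>, the product over
      \<open>Y\<close> has the form of row \<open>k\<close>, which cancels the denominator of
      \<open>simplex_term\<close>.\<close>
    have "(\<Prod>E\<in>Y. x \<bullet> edge_dir E) = (\<Prod>\<sigma>\<in>Some ` Y. l \<sigma> x)"
      by (simp add: prod.reindex l_def)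
    also have "\<dots> = (\<Prod>i | \<tau> i \<noteq> None. l (\<tau> i) x)"
      unfolding im[symmetric] by (subst prod.reindex[OF inj']) simp
    also have "\<dots> = (\<Prod>i\<in>UNIV. l (\<tau> i) x)"
      by (rule prod.mono_neutral_left) (auto simp: l_def)
    also have "\<dots> = l (\<tau> k) x * (\<Prod>i\<in>UNIV - {k}. l (\<tau> i) x)" by (rule prod.remove) auto
    also have "(\<Prod>i\<in>UNIV - {k}. l (\<tau> i) x) = (\<Prod>i\<in>UNIV. if i = k then 1 else l (\<tau> i) x)"
      by (rule prod.mono_neutral_cong_left) auto
    finally have "(\<Prod>E\<in>Y. x \<bullet> edge_dir E) * det (M x) = (x \<bullet> edge_dir E0) * det (A x)"
      by (simp add: dA l_def E0)
    then have e1: "det (A x) = (\<Prod>E\<in>Y. x \<bullet> edge_dir E) * (det (M x) / (x \<bullet> edge_dir E0))"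
      using nzi[OF E0] by (simp add: field_simps)
    have e2: "simplex_term \<omega> x = det (M x) / (x \<bullet> edge_dir E0)"
      by (simp add: simplex_term_def \<tau>k(1) E0 M_def cong: if_cong)
    have e3: "(\<Prod>E\<in>X. x \<bullet> edge_dir E) = (\<Prod>E\<in>X - Y. x \<bullet> edge_dir E) * (\<Prod>E\<in>Y. x \<bullet> edge_dir E)"
      by (rule prod.subset_diff[OF YX X])
    show ?thesis unfolding G_def e1 e2 e3 by (simp only: ac_simps)
  qed
  ultimately show ?thesis by blast
qed

text \<open>The chosen orientation may be either one, so the ends are compared as an unordered
  pair.\<close>

lemma crossing_edge_ends:
  assumes "E \<in> crossing_edges P x"
  obtains p q where "E = closed_segment p q" "x \<bullet> p < 0" "0 < x \<bullet> q" "p \<in> P" "q \<in> P"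
    "{p, q} = {edge_start E, edge_start E + edge_dir E}"
proof -
  obtain p q where pq: "E = closed_segment p q" "x \<bullet> p < 0" "0 < x \<bullet> q" and f: "E face_of P"
    using assms by (auto simp: crossing_edges_def)
  have "E = closed_segment (fst (edge_ends E)) (snd (edge_ends E))"
    unfolding edge_ends_def by (rule someI[of _ "(p, q)"]) (simp add: pq)
  then have "{p, q} = {fst (edge_ends E), snd (edge_ends E)}"
    using pq(1) closed_segment_eq by metis
  moreover have "p \<in> P" "q \<in> P" using face_of_imp_subset[OF f] pq(1) by auto
  ultimately show ?thesis using that pq by (simp add: edge_dir_def)
qed

lemma crossing_edge_dir:
  assumes "E \<in> crossing_edges P x"
  shows "x \<bullet> edge_dir E \<noteq> 0"
proof -
  obtain p q where "x \<bullet> p < 0" "0 < x \<bullet> q" "{p, q} = {edge_start E, edge_start E + edge_dir E}"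
    using crossing_edge_ends[OF assms] by metis
  then show ?thesis by (auto simp: doubleton_eq_iff inner_add_right)
qed

lemma section_point_unique:
  assumes E: "E \<in> crossing_edges P x" and e: "e \<in> E" "x \<bullet> e = 0"
  shows "e = section_point (Some E) x"
proof -
  obtain p q where pq: "E = closed_segment p q" "{p, q} = {edge_start E, edge_start E + edge_dir E}"
    using crossing_edge_ends[OF E] by metis
  have "E = closed_segment (edge_start E) (edge_start E + edge_dir E)"
    using pq closed_segment_eq by metis
  then obtain u where "e = (1 - u) *\<^sub>R edge_start E + u *\<^sub>R (edge_start E + edge_dir E)"
    using e(1) by (metis (no_types, lifting) in_segment(1))
  then have u: "e = edge_start E + u *\<^sub>R edge_dir E" by (simp add: algebra_simps)
  then have "u * (x \<bullet> edge_dir E) = - (x \<bullet> edge_start E)"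
    using e(2) by (simp add: inner_add_right)
  then have "u = - ((x \<bullet> edge_start E) / (x \<bullet> edge_dir E))"
    using crossing_edge_dir[OF E] by (simp add: field_simps)
  then show ?thesis using u by (simp add: section_point_def)
qed

text \<open>As \<open>x\<close> separates the vertices of \<open>P\<close> from 0, a vertex of
  \<open>P\<close> on the hyperplane must be the origin; every other vertex of the section lies on a
  crossing edge.\<close>

lemma extreme_point_of_central_section:
  fixes P :: "'a::euclidean_space set"
  assumes P: "polytope P" and inj: "inj_on ((\<bullet>) x) (insert 0 {v. v extreme_point_of P})"
    and e: "e extreme_point_of (P \<inter> {y. x \<bullet> y = 0})"
  shows "\<exists>\<sigma>\<in>insert None (Some ` crossing_edges P x). e = section_point \<sigma> x"
proof -
  have xe: "x \<bullet> e = 0" using e by (auto simp: extreme_point_of_def)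
  from extreme_point_of_polytope_Int_hyperplane[OF P e] show ?thesis
  proof
    assume "e extreme_point_of P"
    then have "e = 0" using inj_onD[OF inj, of e 0] xe by simp
    then show ?thesis by (simp add: section_point_def)
  next
    assume "\<exists>p q. closed_segment p q face_of P \<and> p \<noteq> q \<and> e \<in> open_segment p q \<and> x \<bullet> p < 0 \<and> 0 < x \<bullet> q"
    then obtain p q where pq: "closed_segment p q face_of P" "p \<noteq> q" "e \<in> open_segment p q"
      "x \<bullet> p < 0" "0 < x \<bullet> q" by blast
    then have "closed_segment p q \<in> crossing_edges P x"
      using aff_dim_closed_segment by (auto simp: crossing_edges_def)
    moreover from this have "e = section_point (Some (closed_segment p q)) x"
      by (rule section_point_unique) (use pq(3) xe in \<open>auto simp: open_segment_def\<close>)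
    ultimately show ?thesis by blast
  qed
qed

text \<open>From an interior point move towards whichever of \<open>p\<close> and \<open>q\<close>
  lies on the other side; the hyperplane is met before the end is reached, hence in the
  interior.\<close>

lemma convex_interior_meets_hyperplane:
  fixes P :: "'a::euclidean_space set"
  assumes P: "convex P" "interior P \<noteq> {}" and pq: "p \<in> P" "q \<in> P" "x \<bullet> p < 0" "0 < x \<bullet> q"
  shows "\<exists>z\<in>interior P. x \<bullet> z = 0"
proof -
  obtain y where y: "y \<in> interior P" using P(2) by blast
  have main: ?thesis if r: "r \<in> P" and s: "(x \<bullet> r) * (x \<bullet> y) < 0" for r
  proof -
    define t where "t = (x \<bullet> r) / (x \<bullet> r - x \<bullet> y)"
    have t: "0 < t" "t \<le> 1" "t * (x \<bullet> r - x \<bullet> y) = x \<bullet> r"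
      using s by (auto simp: t_def field_simps mult_less_0_iff)
    have "r - t *\<^sub>R (r - y) \<in> interior P"
      by (rule mem_interior_convex_shrink[OF P(1) y r t(1,2)])
    moreover have "x \<bullet> (r - t *\<^sub>R (r - y)) = 0" using t(3) by (simp add: inner_diff_right)
    ultimately show ?thesis by blast
  qed
  consider "x \<bullet> y = 0" | "x \<bullet> y < 0" | "0 < x \<bullet> y" by linarith
  then show ?thesis
  proof cases
    case 1 then show ?thesis using y by blast
  next
    case 2 then show ?thesis using main[OF pq(2)] pq(4) by (simp add: mult_pos_neg)
  next
    case 3 then show ?thesis using main[OF pq(1)] pq(3) by (simp add: mult_neg_pos)
  qed
qed

text \<open>A crossing edge forces the hyperplane through the interior. Without one the section is
  at most the origin, and the prism over it is null because the dimension is at least two.\<close>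

lemma isCont_section_volume_generic:
  fixes P :: "(real^'n) set"
  assumes P: "polytope P" "interior P \<noteq> {}" and x: "x \<noteq> 0" and d: "2 \<le> CARD('n)"
    and inj: "inj_on ((\<bullet>) x) (insert 0 {v. v extreme_point_of P})"
  shows "isCont (section_volume P) x"
proof -
  define Q where "Q = P \<inter> {y. x \<bullet> y = 0}"
  have Q: "polytope Q"
    unfolding Q_def by (simp add: P polytope_Int_polyhedron polyhedron_hyperplane)
  have "(\<exists>p\<in>interior P. x \<bullet> p = 0) \<or> negligible (prism Q (sgn x))"
  proof (cases "crossing_edges P x = {}")
    case True
    then have "{v. v extreme_point_of Q} \<subseteq> {0}"
      using extreme_point_of_central_section[OF P(1) inj] by (auto simp: Q_def section_point_def)
    then have "convex hull {v. v extreme_point_of Q} \<subseteq> {0}"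
      by (rule hull_minimal) simp
    then have "Q \<subseteq> {0}"
      using Krein_Milman_Minkowski[OF polytope_imp_compact[OF Q] polytope_imp_convex[OF Q]] by simp
    then have "aff_dim Q \<le> 0" using aff_dim_subset[of Q "{0}"] by simp
    then show ?thesis using d by (intro disjI2 negligible_prism_lowdim) simp
  next
    case False
    then obtain E where "E \<in> crossing_edges P x" by blast
    then obtain p q where "p \<in> P" "q \<in> P" "x \<bullet> p < 0" "0 < x \<bullet> q"
      using crossing_edge_ends by metis
    then show ?thesis
      using convex_interior_meets_hyperplane[OF polytope_imp_convex[OF P(1)] P(2)] by blast
  qed
  then show ?thesis
    unfolding Q_def
    by (rule isCont_section_volume[OF polytope_imp_compact[OF P(1)] polytope_imp_convex[OF P(1)] x])
qed

text \<open>The prisms over a triangulation of the section overlap in null sets, so their volumes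
  add up. \<open>\<kappa>\<close> holds the sign of each simplex term and is 0 on indices that do
  not occur; with three possible values it leaves only finitely many expressions as \<open>x\<close>
  varies.\<close>

lemma radial_IP_expansion:
  fixes P :: "(real^'n) set"
  assumes P: "polytope P" and x: "x \<noteq> 0" and d: "2 \<le> CARD('n)"
    and inj: "inj_on ((\<bullet>) x) (insert 0 {v. v extreme_point_of P})"
    and nz: "section_volume P x \<noteq> 0"
  shows "\<exists>\<kappa>\<in>PiE (simplex_indices (crossing_edges P x)) (\<lambda>_. {-1, 0, 1}). radial_IP P x =
    (\<Sum>\<omega>\<in>simplex_indices (crossing_edges P x).
       \<kappa> \<omega> * measure lebesgue (standard_prism (snd \<omega>)) * simplex_term \<omega> x)"
proof -
  define X where "X = crossing_edges P x"
  define Q where "Q = P \<inter> {y. x \<bullet> y = 0}"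
  have Q: "polytope Q"
    unfolding Q_def by (simp add: P polytope_Int_polyhedron polyhedron_hyperplane)
  have finX: "finite X"
    using finite_polytope_edges[OF P] unfolding X_def crossing_edges_def by (rule rev_finite_subset) auto
  have "aff_dim Q \<le> int CARD('n) - 1"
    using aff_dim_subset[of Q "{y. x \<bullet> y = 0}"] aff_dim_hyperplane[OF x, of 0] by (simp add: Q_def)
  \<comment> \<open>A nonzero volume forces the section to have full dimension in the hyperplane, so
    each simplex has exactly \<open>CARD('n)\<close> vertices.\<close>
  moreover have "\<not> aff_dim Q < int CARD('n) - 1"
    using negligible_prism_lowdim[of Q "sgn x"] nz
    by (auto simp: section_volume_eq_prism Q_def[symmetric] negligible_imp_measure0)
  ultimately have dQ: "aff_dim Q = int CARD('n) - 1" by simp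
  obtain T where T: "finite T"
    "\<forall>t\<in>T. t \<subseteq> {x. x extreme_point_of Q} \<and> finite t \<and> int (card t) = aff_dim Q + 1"
    "Q = (\<Union>t\<in>T. convex hull t)"
    "pairwise (\<lambda>s t. aff_dim (convex hull s \<inter> convex hull t) < aff_dim Q) T"
    using polytope_triangulation[OF Q] by blast
  have sub: "convex hull t \<subseteq> {y. x \<bullet> y = 0}" if "t \<in> T" for t
    using T(3) that by (auto simp: Q_def)
  have "prism Q (sgn x) = (\<Union>t\<in>T. prism (convex hull t) (sgn x))"
    unfolding T(3) by (auto simp: prism_def)
  then have "section_volume P x = measure lebesgue (\<Union>t\<in>T. prism (convex hull t) (sgn x))"
    by (simp add: section_volume_eq_prism Q_def)
  also have "\<dots> = (\<Sum>t\<in>T. measure lebesgue (prism (convex hull t) (sgn x)))"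
  proof (rule measure_negligible_finite_Union_image[OF T(1)])
    fix t assume t: "t \<in> T"
    have "compact ((\<lambda>(y, s). y + s *\<^sub>R sgn x) ` ((convex hull t) \<times> {0..1}))"
      using T(2) t
      by (intro compact_continuous_image compact_Times finite_imp_compact_convex_hull)
        (auto simp: case_prod_unfold intro!: continuous_intros)
    moreover have "(\<lambda>(y, s). y + s *\<^sub>R sgn x) ` ((convex hull t) \<times> {0..1}) = prism (convex hull t) (sgn x)"
      unfolding prism_def by (auto; blast)
    ultimately show "prism (convex hull t) (sgn x) \<in> lmeasurable" by (metis lmeasurable_compact)
  next
    show "pairwise (\<lambda>s t. negligible (prism (convex hull s) (sgn x) \<inter> prism (convex hull t) (sgn x))) T"
    proof (rule pairwiseI)
      fix s t assume st: "s \<in> T" "t \<in> T" "s \<noteq> t"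
      have xx: "x \<bullet> sgn x \<noteq> 0" using x by (simp add: sgn_div_norm)
      \<comment> \<open>The functional \<open>x\<close> reads off the height, so a point common to
        two prisms has the same foot in both.\<close>
      have "prism (convex hull s) (sgn x) \<inter> prism (convex hull t) (sgn x)
          \<subseteq> prism (convex hull s \<inter> convex hull t) (sgn x)"
      proof
        fix z assume "z \<in> prism (convex hull s) (sgn x) \<inter> prism (convex hull t) (sgn x)"
        then obtain y a y' a' where z: "z = y + a *\<^sub>R sgn x" "z = y' + a' *\<^sub>R sgn x"
          "y \<in> convex hull s" "y' \<in> convex hull t" "a \<in> {0..1}"
          unfolding prism_def by blast
        have "x \<bullet> y = 0" "x \<bullet> y' = 0" using z(3,4) sub[OF st(1)] sub[OF st(2)] by blast+
        then have "x \<bullet> z = a * (x \<bullet> sgn x)" "x \<bullet> z = a' * (x \<bullet> sgn x)"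
          by (simp add: z(1) inner_add_right, simp add: z(2) inner_add_right)
        then have "a = a'" using xx by simp
        then have "y = y'" using z by simp
        then show "z \<in> prism (convex hull s \<inter> convex hull t) (sgn x)"
          using z by (auto simp: prism_def)
      qed
      moreover have "negligible (prism (convex hull s \<inter> convex hull t) (sgn x))"
        using T(4) st dQ by (intro negligible_prism_lowdim) (auto simp: pairwise_def)
      ultimately show "negligible (prism (convex hull s) (sgn x) \<inter> prism (convex hull t) (sgn x))"
        by (rule negligible_subset[rotated])
    qed
  qed
  finally have rad: "radial_IP P x = (\<Sum>t\<in>T. measure lebesgue (prism (convex hull t) (sgn x)) / norm x)"
    by (simp add: radial_IP_def sum_divide_distrib)
  define c :: "('n \<Rightarrow> (real^'n) set option) \<times> 'n \<Rightarrow> real"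
    where "c = (\<lambda>\<omega>. measure lebesgue (standard_prism (snd \<omega>)))"
  \<comment> \<open>The second conjunct recovers the simplex from its index, which makes the choice
    function \<open>W\<close> injective.\<close>
  have "\<forall>t\<in>T. \<exists>\<omega>. \<omega> \<in> simplex_indices X \<and> t = (\<lambda>i. section_point (fst \<omega> i) x) ` UNIV \<and>
      measure lebesgue (prism (convex hull t) (sgn x)) / norm x = c \<omega> * \<bar>simplex_term \<omega> x\<bar>"
  proof
    fix t assume t: "t \<in> T"
    have "card t = CARD('n)" "finite t" using T(2) t dQ by auto
    then obtain v :: "'n \<Rightarrow> real^'n" where v: "bij_betw v UNIV t"
      using finite_same_card_bij[of "UNIV :: 'n set" t] by auto
    then have rv: "range v = t" and iv: "inj v" by (auto simp: bij_betw_def)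
    have "\<exists>\<sigma>. \<sigma> \<in> insert None (Some ` X) \<and> v i = section_point \<sigma> x" for i
    proof -
      have "v i \<in> t" using rv by blast
      then have "v i extreme_point_of Q" using bspec[OF T(2) t] by blast
      from extreme_point_of_central_section[OF P inj this[unfolded Q_def]]
      show ?thesis unfolding X_def by (simp only: Bex_def)
    qed
    then obtain \<tau> where \<tau>: "\<And>i. \<tau> i \<in> insert None (Some ` X)" "\<And>i. v i = section_point (\<tau> i) x"
      by metis
    have i\<tau>: "inj \<tau>" using iv \<tau>(2) unfolding inj_def by metis
    \<comment> \<open>By injectivity at most one vertex is labelled \<open>None\<close>, and there
      are at least two vertices.\<close>
    obtain k where k: "\<tau> k \<noteq> None"
    proof (rule ccontr)
      assume "\<not> thesis"
      then have "\<forall>k. \<tau> k = None" using that by blast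
      then have "i = j" for i j :: 'n using i\<tau> by (metis injD)
      then have "CARD('n) \<le> Suc 0" by (simp add: card_le_Suc0_iff_eq)
      then show False using d by simp
    qed
    then obtain E where E: "\<tau> k = Some E" by auto
    then have EX: "E \<in> crossing_edges P x" using \<tau>(1)[of k] by (auto simp: X_def)
    have xv: "x \<bullet> v i = 0" for i
      using sub[OF t] rv hull_inc[of "v i" t convex] by auto
    have vk: "v k = edge_start E + (- ((x \<bullet> edge_start E) / (x \<bullet> edge_dir E))) *\<^sub>R edge_dir E"
      by (simp add: \<tau>(2) E section_point_def)
    have "measure lebesgue (prism (convex hull t) (sgn x)) / norm x = c (\<tau>, k) * \<bar>simplex_term (\<tau>, k) x\<bar>"
      using measure_prism_section_simplex[OF iv x xv crossing_edge_dir[OF EX] vk]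
      unfolding rv by (simp add: c_def simplex_term_def E \<tau>(2) cong: if_cong)
    moreover have "(\<tau>, k) \<in> simplex_indices X"
      using i\<tau> \<tau>(1) k by (auto simp: simplex_indices_def)
    moreover have "t = (\<lambda>i. section_point (\<tau> i) x) ` UNIV" using rv \<tau>(2) by auto
    ultimately show "\<exists>\<omega>. \<omega> \<in> simplex_indices X \<and> t = (\<lambda>i. section_point (fst \<omega> i) x) ` UNIV \<and>
      measure lebesgue (prism (convex hull t) (sgn x)) / norm x = c \<omega> * \<bar>simplex_term \<omega> x\<bar>"
      by (intro exI[of _ "(\<tau>, k)"]) simp
  qed
  from bchoice[OF this] obtain W where W: "\<forall>t\<in>T. W t \<in> simplex_indices X \<and>
    t = (\<lambda>i. section_point (fst (W t) i) x) ` UNIV \<and>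
    measure lebesgue (prism (convex hull t) (sgn x)) / norm x = c (W t) * \<bar>simplex_term (W t) x\<bar>" ..
  have injW: "inj_on W T"
  proof (rule inj_onI)
    fix s t assume "s \<in> T" "t \<in> T" "W s = W t"
    then show "s = t" using W by metis
  qed
  \<comment> \<open>Restriction to the index set places \<open>\<kappa>\<close> in the finite set of
    functions from which the covering polynomials are formed.\<close>
  define \<kappa> where "\<kappa> = restrict (\<lambda>\<omega>. if \<omega> \<in> W ` T then sgn (simplex_term \<omega> x) else 0) (simplex_indices X)"
  have WT: "W ` T \<subseteq> simplex_indices X" using W by blast
  have "radial_IP P x = (\<Sum>t\<in>T. c (W t) * \<bar>simplex_term (W t) x\<bar>)"
    unfolding rad using W by (intro sum.cong) auto
  also have "\<dots> = (\<Sum>\<omega>\<in>W ` T. c \<omega> * \<bar>simplex_term \<omega> x\<bar>)"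
    by (simp add: sum.reindex[OF injW])
  also have "\<dots> = (\<Sum>\<omega>\<in>simplex_indices X. \<kappa> \<omega> * c \<omega> * simplex_term \<omega> x)"
  proof (rule sum.mono_neutral_cong_left[OF finite_simplex_indices[OF finX] WT])
    show "\<forall>\<omega>\<in>simplex_indices X - W ` T. \<kappa> \<omega> * c \<omega> * simplex_term \<omega> x = 0"
      by (simp add: \<kappa>_def)
    fix \<omega> assume \<omega>: "\<omega> \<in> W ` T"
    then have "\<kappa> \<omega> = sgn (simplex_term \<omega> x)" using WT by (auto simp: \<kappa>_def)
    then show "c \<omega> * \<bar>simplex_term \<omega> x\<bar> = \<kappa> \<omega> * c \<omega> * simplex_term \<omega> x"
      by (simp add: abs_sgn algebra_simps)
  qed
  finally have "radial_IP P x = (\<Sum>\<omega>\<in>simplex_indices X. \<kappa> \<omega> * c \<omega> * simplex_term \<omega> x)" .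
  moreover have "\<kappa> \<in> PiE (simplex_indices X) (\<lambda>_. {-1, 0, 1})"
    by (auto simp: \<kappa>_def sgn_if)
  ultimately show ?thesis unfolding X_def c_def by blast
qed

text \<open>By continuity a value above 1 puts a neighbourhood of \<open>x\<close> inside the body,
  and a value below 1 puts one outside.\<close>

lemma frontier_intersection_body:
  fixes P :: "(real^'n) set"
  assumes x: "x \<in> frontier (intersection_body P)" "x \<noteq> 0" and c: "isCont (section_volume P) x"
  shows "radial_IP P x = 1"
proof (rule ccontr)
  assume "radial_IP P x \<noteq> 1"
  have cont: "isCont (radial_IP P) x"
    unfolding radial_IP_def using x(2) by (intro continuous_intros c) auto
  have ne: "\<forall>\<^sub>F y in nhds x. y \<noteq> 0"
    using eventually_nhds_in_open[OF open_Compl[OF closed_singleton], of x 0] x(2) by simp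
  have lim: "(radial_IP P \<longlongrightarrow> radial_IP P x) (nhds x)"
    using cont by (simp add: isCont_def tendsto_at_iff_tendsto_nhds)
  consider "radial_IP P x > 1" | "radial_IP P x < 1" using \<open>radial_IP P x \<noteq> 1\<close> by linarith
  then show False
  proof cases
    case 1
    have "\<forall>\<^sub>F y in nhds x. y \<in> intersection_body P"
      using order_tendstoD(1)[OF lim 1] ne
      by eventually_elim (simp add: intersection_body_def)
    then have "x \<in> interior (intersection_body P)"
      by (auto simp: eventually_nhds interior_def)
    then show False using x(1) by (simp add: frontier_def)
  next
    case 2
    have "\<forall>\<^sub>F y in nhds x. y \<in> - intersection_body P"
      using order_tendstoD(2)[OF lim 2] ne
      by eventually_elim (simp add: intersection_body_def)
    then have "x \<in> interior (- intersection_body P)"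
      by (auto simp: eventually_nhds interior_def)
    then show False using x(1) by (simp add: frontier_def interior_complement)
  qed
qed

text \<open>Linear forms in \<open>L\<close> take care of the non-generic points, and the functions
  in \<open>H\<close>, which are the equations \<open>\<rho>(x) = 1\<close> cleared of denominators,
  take care of the generic ones.\<close>

lemma frontier_intersection_body_covered:
  fixes P :: "(real^'n) set"
  assumes P: "polytope P" "interior P \<noteq> {}" and d: "2 \<le> CARD('n)"
  obtains F where "finite F" "\<And>f. f \<in> F \<Longrightarrow> poly_fun (num_edges P - (CARD('n) - 1)) f"
    "\<And>f. f \<in> F \<Longrightarrow> \<exists>x. f x \<noteq> 0" "\<And>x. x \<in> frontier (intersection_body P) \<Longrightarrow> \<exists>f\<in>F. f x = 0"
proof -
  define V where "V = insert 0 {v. v extreme_point_of P}"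
  define \<E> where "\<E> = {E. E face_of P \<and> aff_dim E = 1}"
  define m where "m = num_edges P - (CARD('n) - 1)"
  have ne: "num_edges P = card \<E>" by (simp add: num_edges_def \<E>_def)
  have finV: "finite V" using polytope_finite_extreme_points[OF P(1)] by (simp add: V_def)
  have finE: "finite \<E>" unfolding \<E>_def by (rule finite_polytope_edges[OF P(1)])
  have m1: "1 \<le> m"
  proof -
    obtain c where "inj_on ((\<bullet>) c) {v. v extreme_point_of P}"
      using exists_injective_functional[OF polytope_finite_extreme_points[OF P(1)]] by blast
    from card_edges_ge_DIM[OF P this] have "CARD('n) \<le> card \<E>" by (simp add: \<E>_def)
    then show ?thesis using d by (simp add: m_def ne)
  qed
  \<comment> \<open>The numerators are chosen from \<open>X\<close> and \<open>\<omega>\<close>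
    alone, independently of \<open>x\<close>, so that \<open>H\<close> is finite.\<close>
  define G where "G = (\<lambda>X \<omega>. SOME G. poly_fun (card X) G \<and> (\<forall>x :: real^'n. (\<forall>E\<in>X. x \<bullet> edge_dir E \<noteq> 0)
      \<longrightarrow> G x = (\<Prod>E\<in>X. x \<bullet> edge_dir E) * simplex_term \<omega> x))"
  have G: "poly_fun (card X) (G X \<omega>)"
    "\<And>x. \<forall>E\<in>X. x \<bullet> edge_dir E \<noteq> 0 \<Longrightarrow> G X \<omega> x = (\<Prod>E\<in>X. x \<bullet> edge_dir E) * simplex_term \<omega> x"
    if "finite X" "\<omega> \<in> simplex_indices X" for X \<omega>
  proof -
    have "poly_fun (card X) (G X \<omega>) \<and> (\<forall>x. (\<forall>E\<in>X. x \<bullet> edge_dir E \<noteq> 0)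
      \<longrightarrow> G X \<omega> x = (\<Prod>E\<in>X. x \<bullet> edge_dir E) * simplex_term \<omega> x)"
      unfolding G_def by (rule someI_ex[OF simplex_term_clear_denominators[OF that]])
    then show "poly_fun (card X) (G X \<omega>)"
      "\<And>x. \<forall>E\<in>X. x \<bullet> edge_dir E \<noteq> 0 \<Longrightarrow> G X \<omega> x = (\<Prod>E\<in>X. x \<bullet> edge_dir E) * simplex_term \<omega> x"
      by blast+
  qed
  define h where "h = (\<lambda>X \<kappa> x. (\<Prod>E\<in>X. x \<bullet> edge_dir E) -
    (\<Sum>\<omega>\<in>simplex_indices X. \<kappa> \<omega> * measure lebesgue (standard_prism (snd \<omega>)) * G X \<omega> x))"
  define K where "K = (\<lambda>X :: (real^'n) set set. PiE (simplex_indices X) (\<lambda>_. {-1, 0, 1 :: real}))"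
  define H where "H = (\<Union>X\<in>Pow \<E>. h X ` K X)"
  define L where "L = (\<lambda>(u, v) x. x \<bullet> (u - v)) ` {(u, v) \<in> V \<times> V. u \<noteq> v}"
  \<comment> \<open>With the degree bound and nonvanishing built into \<open>F\<close>, they need
    proof only for functions that occur at some boundary point.\<close>
  define F where "F = {f \<in> H \<union> L. poly_fun m f \<and> (\<exists>x. f x \<noteq> 0)}"
  have finH: "finite H"
    unfolding H_def K_def using finE
    by (auto intro!: finite_UN_I finite_imageI finite_PiE finite_simplex_indices intro: finite_subset)
  have "finite {(u, v) \<in> V \<times> V. u \<noteq> v}"
    by (rule finite_subset[of _ "V \<times> V"]) (use finV in auto)
  then have "finite F" using finH by (simp add: F_def L_def)
  moreover have "\<exists>f\<in>F. f x = 0" if x: "x \<in> frontier (intersection_body P)" for x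
  proof (cases "inj_on ((\<bullet>) x) V")
    case False
    then obtain u v where uv: "u \<in> V" "v \<in> V" "u \<noteq> v" "x \<bullet> u = x \<bullet> v" by (auto simp: inj_on_def)
    define f where "f = (\<lambda>x. x \<bullet> (u - v))"
    have "f \<in> L" unfolding L_def f_def using uv by (intro image_eqI[of _ _ "(u, v)"]) auto
    moreover have "poly_fun m f" unfolding f_def using poly_fun_mono[OF poly_fun_inner m1] .
    moreover have "f (u - v) \<noteq> 0" using uv by (simp add: f_def)
    ultimately have "f \<in> F" by (auto simp: F_def)
    moreover have "f x = 0" using uv by (simp add: f_def inner_diff_right)
    ultimately show ?thesis by blast
  next
    case True
    have x0: "x \<noteq> 0"
    proof
      assume "x = 0"
      then have "\<forall>u\<in>V. u = 0" using True by (auto simp: inj_on_def V_def)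
      then have "{v. v extreme_point_of P} \<subseteq> {0}" by (auto simp: V_def)
      then have "card {v. v extreme_point_of P} \<le> card {0 :: real^'n}" by (intro card_mono) auto
      then show False using card_vertices_ge[OF P] d by simp
    qed
    note inj = True[unfolded V_def]
    have rad: "radial_IP P x = 1"
      by (rule frontier_intersection_body[OF x x0 isCont_section_volume_generic[OF P x0 d inj]])
    then have "section_volume P x \<noteq> 0" by (auto simp: radial_IP_def)
    define X where "X = crossing_edges P x"
    have XE: "X \<subseteq> \<E>" by (auto simp: X_def crossing_edges_def \<E>_def)
    have finX: "finite X" using XE finE finite_subset by blast
    obtain \<kappa> where \<kappa>: "\<kappa> \<in> K X" "radial_IP P x = (\<Sum>\<omega>\<in>simplex_indices X.
        \<kappa> \<omega> * measure lebesgue (standard_prism (snd \<omega>)) * simplex_term \<omega> x)"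
      using radial_IP_expansion[OF P(1) x0 d inj \<open>section_volume P x \<noteq> 0\<close>] unfolding X_def K_def by blast
    define f where "f = h X \<kappa>"
    have "f \<in> H" unfolding H_def f_def using XE \<kappa>(1) by blast
    have "inj_on ((\<bullet>) x) {v. v extreme_point_of P}" using inj by (rule inj_on_subset) auto
    from card_crossing_edges_le[OF P this] have "card X \<le> m" by (simp add: X_def m_def ne \<E>_def)
    moreover have "poly_fun (card X) f"
    proof -
      have "poly_fun (\<Sum>E\<in>X. 1) (\<lambda>x. \<Prod>E\<in>X. x \<bullet> edge_dir E)"
        using finX by (intro poly_fun_prod poly_fun_inner)
      then show ?thesis
        unfolding f_def h_def by (intro poly_fun_diff poly_fun_sum poly_fun_cmult G(1)[OF finX]) simp_all
    qed
    ultimately have pf: "poly_fun m f" using poly_fun_mono by blast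
    have dir: "\<forall>E\<in>X. x \<bullet> edge_dir E \<noteq> 0" using crossing_edge_dir by (auto simp: X_def)
    \<comment> \<open>On the ray through \<open>x\<close> the sign pattern and edge set are kept
      fixed. By homogeneity the second factor vanishes at \<open>c = 1\<close> but not at
      \<open>c = 2\<close>, so \<open>f\<close> is a nonzero function with zero
      \<open>x\<close>.\<close>
    have f: "f (c *\<^sub>R x) = (\<Prod>E\<in>X. (c *\<^sub>R x) \<bullet> edge_dir E) * (1 - 1 / c)" if "c \<noteq> 0" for c
    proof -
      have dir': "\<forall>E\<in>X. (c *\<^sub>R x) \<bullet> edge_dir E \<noteq> 0" using dir that by simp
      have "f (c *\<^sub>R x) = (\<Prod>E\<in>X. (c *\<^sub>R x) \<bullet> edge_dir E) - (\<Sum>\<omega>\<in>simplex_indices X.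
          \<kappa> \<omega> * measure lebesgue (standard_prism (snd \<omega>)) *
            ((\<Prod>E\<in>X. (c *\<^sub>R x) \<bullet> edge_dir E) * (simplex_term \<omega> x / c)))"
        unfolding f_def h_def
        by (intro arg_cong2[of _ _ _ _ "(-)"] sum.cong refl)
          (simp only: G(2)[OF finX _ dir'] simplex_term_scaleR[OF that])
      also have "\<dots> = (\<Prod>E\<in>X. (c *\<^sub>R x) \<bullet> edge_dir E) * (1 - radial_IP P x / c)"
        unfolding \<kappa>(2) by (simp add: right_diff_distrib sum_divide_distrib sum_distrib_left algebra_simps)
      finally show ?thesis using rad by simp
    qed
    have "f x = 0" using f[of 1] by simp
    moreover have "(\<Prod>E\<in>X. (2 *\<^sub>R x) \<bullet> edge_dir E) \<noteq> 0" using dir finX by simp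
    then have "f (2 *\<^sub>R x) \<noteq> 0" by (simp only: f[of 2]) simp
    then have "f \<in> F" using \<open>f \<in> H\<close> pf by (auto simp: F_def)
    ultimately show ?thesis by blast
  qed
  moreover have "poly_fun m f" "\<exists>x. f x \<noteq> 0" if "f \<in> F" for f using that by (auto simp: F_def)
  ultimately show ?thesis using that[of F] unfolding m_def by blast
qed

text \<open>On a line every central section is contained in the origin, over which a prism need not
  be null. The section volume depends only on the sign of the coordinate, so the boundary points
  take finitely many values and linear polynomials cover them.\<close>

lemma frontier_intersection_body_covered_1:
  fixes P :: "(real^'n) set"
  assumes P: "polytope P" "interior P \<noteq> {}" and d: "CARD('n) = 1"
  obtains F where "finite F" "\<And>f. f \<in> F \<Longrightarrow> poly_fun (num_edges P - (CARD('n) - 1)) f"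
    "\<And>f. f \<in> F \<Longrightarrow> \<exists>x. f x \<noteq> 0" "\<And>x. x \<in> frontier (intersection_body P) \<Longrightarrow> \<exists>f\<in>F. f x = 0"
proof -
  obtain i :: 'n where i: "UNIV = {i}" using d card_1_singletonE by blast
  have all: "j = i" for j using i by auto
  define e :: "real^'n" where "e = axis i 1"
  have inner: "y \<bullet> z = y $ i * z $ i" for y z :: "real^'n" by (simp add: inner_vec_def i)
  have nrm: "norm y = \<bar>y $ i\<bar>" for y :: "real^'n" by (simp add: norm_eq_sqrt_inner inner)
  have sg: "sgn y = sgn (y $ i) *\<^sub>R e" for y :: "real^'n"
  proof (rule vec_eq_iff[THEN iffD2], rule allI)
    fix j show "sgn y $ j = (sgn (y $ i) *\<^sub>R e) $ j"
      unfolding all[of j] by (simp add: e_def sgn_div_norm nrm sgn_if)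
  qed
  define s where "s = (\<lambda>r. measure lebesgue (prism (P \<inter> {0}) (r *\<^sub>R e)))"
  have sv: "section_volume P y = s (sgn (y $ i))" if "y \<noteq> 0" for y
  proof -
    have "y $ i \<noteq> 0" using that all by (metis vec_eq_iff zero_index)
    moreover have "z = 0" if "z $ i = 0" for z :: "real^'n" using that all by (metis vec_eq_iff zero_index)
    ultimately have "{z. y \<bullet> z = 0} = {0}" by (auto simp: inner)
    then show ?thesis by (simp add: section_volume_eq_prism sg s_def)
  qed
  \<comment> \<open>All possible solutions of \<open>\<bar>x $ i\<bar> = s (sgn (x $ i))\<close>,
    together with the origin.\<close>
  define S where "S = {0, s 1, - s 1, s (-1), - s (-1)}"
  define F where "F = (\<lambda>a (x :: real^'n). x $ i - a) ` S"
  have "1 \<le> num_edges P"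
  proof -
    obtain c where "inj_on ((\<bullet>) c) {v. v extreme_point_of P}"
      using exists_injective_functional[OF polytope_finite_extreme_points[OF P(1)]] by blast
    from card_edges_ge_DIM[OF P this] show ?thesis using d by (simp add: num_edges_def)
  qed
  then have "poly_fun (num_edges P - (CARD('n) - 1)) f" if "f \<in> F" for f
    using that d by (auto simp: F_def intro!: poly_fun_diff poly_fun_const poly_fun_mono[OF poly_fun_component])
  moreover have "\<exists>x. f x \<noteq> 0" if "f \<in> F" for f
  proof -
    obtain a where "f = (\<lambda>x. x $ i - a)" using \<open>f \<in> F\<close> by (auto simp: F_def)
    then have "f ((a + 1) *\<^sub>R e) \<noteq> 0" by (simp add: e_def)
    then show ?thesis ..
  qed
  moreover have "\<exists>f\<in>F. f x = 0" if x: "x \<in> frontier (intersection_body P)" for x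
  proof -
    have "x $ i \<in> S"
    proof (cases "x = 0")
      case False
      then have xi: "x $ i \<noteq> 0" using all by (metis vec_eq_iff zero_index)
      have "open {y :: real^'n. 0 < x \<bullet> y}" by (rule open_halfspace_gt)
      moreover have "x \<in> {y. 0 < x \<bullet> y}" using False by simp
      ultimately have "\<forall>\<^sub>F y in nhds x. y \<in> {y. 0 < x \<bullet> y}" by (rule eventually_nhds_in_open)
      then have "\<forall>\<^sub>F y in nhds x. section_volume P y = section_volume P x"
      proof (rule eventually_mono)
        fix y assume "y \<in> {y. 0 < x \<bullet> y}"
        then have "0 < x $ i * y $ i" by (simp add: inner)
        then have "y \<noteq> 0" "sgn (y $ i) = sgn (x $ i)" by (auto simp: zero_less_mult_iff)
        then show "section_volume P y = section_volume P x" using sv False by simp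
      qed
      then have "isCont (section_volume P) x"
        using isCont_cong[of "section_volume P" "\<lambda>_. section_volume P x" x] by simp
      from frontier_intersection_body[OF x False this]
      have "\<bar>x $ i\<bar> = s (sgn (x $ i))" using False xi by (simp add: radial_IP_def nrm sv)
      then show ?thesis using xi by (auto simp: S_def sgn_if abs_if split: if_splits)
    qed (simp add: S_def)
    then show ?thesis by (auto simp: F_def)
  qed
  ultimately show ?thesis using that[of F] by (simp add: F_def S_def)
qed

theorem theorem5p6:
  fixes P :: "(real^'n) set" and C :: "(real^'n) set"
  assumes "polytope P"
    and "interior P \<noteq> {}"
    and "irreducible_component C (algebraic_boundary (intersection_body P))"
  shows "int (hypersurface_degree C) \<le> int (num_edges P) - (int CARD('n) - 1)"
proof -
  have C: "zariski_irreducible C" "C \<subseteq> zariski_closure (frontier (intersection_body P))"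
    using assms(3) by (auto simp: irreducible_component_def algebraic_boundary_def)
  have card: "1 \<le> CARD('n)" by (simp add: Suc_leI)
  then consider "CARD('n) = 1" | "2 \<le> CARD('n)" by linarith
  then obtain F where "finite F" "\<And>f. f \<in> F \<Longrightarrow> poly_fun (num_edges P - (CARD('n) - 1)) f"
    "\<And>f. f \<in> F \<Longrightarrow> \<exists>x. f x \<noteq> 0" "\<And>x. x \<in> frontier (intersection_body P) \<Longrightarrow> \<exists>f\<in>F. f x = 0"
    using frontier_intersection_body_covered[OF assms(1,2)]
      frontier_intersection_body_covered_1[OF assms(1,2)] by metis
  then have "hypersurface_degree C \<le> num_edges P - (CARD('n) - 1)"
    by (rule hypersurface_degree_le[OF C])
  \<comment> \<open>There are at least \<open>CARD('n)\<close> edges, so the truncated subtraction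
    agrees with the integer difference.\<close>
  moreover obtain c where "inj_on ((\<bullet>) c) {v. v extreme_point_of P}"
    using exists_injective_functional[OF polytope_finite_extreme_points[OF assms(1)]] by blast
  from card_edges_ge_DIM[OF assms(1,2) this] have "CARD('n) \<le> num_edges P"
    by (simp add: num_edges_def)
  ultimately show ?thesis using card by linarith
qed

end
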